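(* Let $P(\lambda)$ be an $n\times n$ complex matrix polynomial with nonsingular leading coefficient and let $w$ be a weight polynomial as in the context. Let $\varepsilon>0$ and assume that $\Lambda_\varepsilon(P)\neq\mathbb{C}$. Then the boundary $\partial\Lambda_\varepsilon(P)$ of $\Lambda_\varepsilon(P)$ lies on an algebraic curve. In particular, $\partial\Lambda_\varepsilon(P)$ is a piecewise $C^\infty$ curve, it has at most a finite number of singularities where the tangent fails to exist, and it intersects itself only at a finite number of points.
   Context: $P(\lambda)=P_m\lambda^m+\cdots+P_1\lambda+P_0$ with $m\ge 1$, $P_j\in\mathbb{C}^{n\times n}$ and $\det P_m\neq 0$. The weight polynomial is $w(x)=\sum_{j=0}^m w_jx^j$ with real $w_j\ge 0$ for $j=1,\dots,m$ and $w_0>0$. $\|\cdot\|$ is the spectral matrix norm. For $\varepsilon\ge 0$, $\mathcal{B}(P,\varepsilon,w)$ is the set of matrix polynomials $Q(\lambda)=\sum_{j=0}^m(P_j+\Delta_j)\lambda^j$ with $\Delta_j\in\mathbb{C}^{n\times n}$ and $\|\Delta_j\|\le\varepsilon w_j$ for $j=0,\dots,m$. The $\varepsilon$-pseudospectrum of $P(\lambda)$ is $\Lambda_\varepsilon(P)=\{\mu\in\mathbb{C}:\det Q(\mu)=0\text{ for some }Q\in\mathcal{B}(P,\varepsilon,w)\}$; equivalently $\Lambda_\varepsilon(P)=\{\lambda\in\mathbb{C}: s_n(\lambda)\le\varepsilon w(|\lambda|)\}$, where $s_n(\lambda)$ is the smallest singular value of $P(\lambda)$. With $\mathbb{C}$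 identified with $\mathbb{R}^2$ via $\lambda=x+iy$, an algebraic curve is the zero set in $\mathbb{R}^2$ of a real polynomial in $x,y$ that is not identically zero. *)

theory Defs
  imports "HOL-Analysis.Analysis" "HOL-Computational_Algebra.Polynomial"
begin

text \<open>A matrix polynomial of degree at most \<open>m\<close> and the weight polynomial are given by their
  coefficient sequences; only the entries with index at most \<open>m\<close> are ever used.\<close>

definition matpoly_eval :: "nat \<Rightarrow> (nat \<Rightarrow> complex^'n^'n) \<Rightarrow> complex \<Rightarrow> complex^'n^'n" where
  "matpoly_eval m P z = (\<Sum>j\<le>m. mat (z ^ j) ** P j)"

text \<open>The norm on \<open>complex^'n\<close> is the Euclidean one, so this is the largest singular value.\<close>

definition spectral_norm :: "complex^'n^'n \<Rightarrow> real" where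
  "spectral_norm A = onorm (\<lambda>v. A *v v)"

definition perturbations ::
    "nat \<Rightarrow> (nat \<Rightarrow> complex^'n^'n) \<Rightarrow> real \<Rightarrow> (nat \<Rightarrow> real) \<Rightarrow> (nat \<Rightarrow> complex^'n^'n) set" where
  "perturbations m P \<epsilon> w =
     {\<lambda>j. P j + \<Delta> j | \<Delta>. \<forall>j\<le>m. spectral_norm (\<Delta> j) \<le> \<epsilon> * w j}"

definition pseudospectrum ::
    "nat \<Rightarrow> (nat \<Rightarrow> complex^'n^'n) \<Rightarrow> real \<Rightarrow> (nat \<Rightarrow> real) \<Rightarrow> complex set" where
  "pseudospectrum m P \<epsilon> w =
     {\<mu>. \<exists>Q\<in>perturbations m P \<epsilon> w. det (matpoly_eval m Q \<mu>) = 0}"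

text \<open>Bivariate real polynomials are rendered as \<open>real poly poly\<close>: the inner variable is \<open>x\<close>,
  the outer variable is \<open>y\<close>.\<close>

definition algebraic_curve :: "complex set \<Rightarrow> bool" where
  "algebraic_curve C \<longleftrightarrow>
     (\<exists>p :: real poly poly. p \<noteq> 0 \<and> C = {z. poly (poly p [:Im z:]) (Re z) = 0})"

definition smooth_regular_on :: "real set \<Rightarrow> (real \<Rightarrow> complex) \<Rightarrow> bool" where
  "smooth_regular_on U \<gamma> \<longleftrightarrow>
     (\<exists>D. D 0 = \<gamma> \<and>
        (\<forall>k. \<forall>t\<in>U. (D k has_vector_derivative D (Suc k) t) (at t)) \<and>
        (\<forall>t\<in>U. D 1 t \<noteq> 0))"

text \<open>A curve is a finite family of parametrised pieces. Several pieces, and unbounded parameter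
  intervals, are needed because the boundary of a pseudospectrum may be disconnected or unbounded.
  Properness makes the image of each piece contain its end points (or run off to infinity);
  without it a crossing could be hidden by parametrising each branch on an interval that stops
  just short of the crossing point. As for \<open>piecewise_C1_differentiable_on\<close>, smoothness is required
  off a finite set of parameters; there the derivative must not vanish, since otherwise corners
  could be parametrised smoothly.\<close>

type_synonym curve = "(real set \<times> (real \<Rightarrow> complex)) list"

definition piecewise_smooth_curve :: "curve \<Rightarrow> bool" where
  "piecewise_smooth_curve c \<longleftrightarrow>
     (\<forall>(I, \<gamma>)\<in>set c.
        is_interval I \<and> interior I \<noteq> {} \<and>
        continuous_on I \<gamma> \<and> proper_map (top_of_set I) euclidean \<gamma> \<and>
        (\<exists>F. finite F \<and> smooth_regular_on (interior I - F) \<gamma>))"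

definition curve_image :: "curve \<Rightarrow> complex set" where
  "curve_image c = (\<Union>(I, \<gamma>)\<in>set c. \<gamma> ` I)"

text \<open>Points attained at two different parameters, also counting common points of different
  pieces.\<close>

definition self_intersections :: "curve \<Rightarrow> complex set" where
  "self_intersections c =
     {z. \<exists>i<length c. \<exists>j<length c. \<exists>s\<in>fst (c ! i). \<exists>t\<in>fst (c ! j).
        (i, s) \<noteq> (j, t) \<and> snd (c ! i) s = z \<and> snd (c ! j) t = z}"

text \<open>The contingent (Bouligand) cone: all limits of positively rescaled secants at \<open>z\<close>.\<close>

definition tangent_cone :: "complex set \<Rightarrow> complex \<Rightarrow> complex set" where
  "tangent_cone S z =
     {v. \<exists>x t. (\<forall>k::nat. x k \<in> S \<and> t k > 0) \<and> t \<longlonglongrightarrow> 0 \<and>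
           (\<lambda>k. (x k - z) /\<^sub>R t k) \<longlonglongrightarrow> v}"

text \<open>The cone has to be a full line: at a corner, a cusp, an end point or a crossing of branches
  with different directions there is no tangent.\<close>

definition has_tangent :: "complex set \<Rightarrow> complex \<Rightarrow> bool" where
  "has_tangent S z \<longleftrightarrow> (\<exists>u. u \<noteq> 0 \<and> tangent_cone S z = span {u})"

end

theory Submission
  imports Defs "HOL-Complex_Analysis.Great_Picard"
begin

text \<open>Write \<open>L\<close> for the pseudospectrum, \<open>W = weight m w\<close>, and
  \<open>s(z)\<close> for the smallest singular value of \<open>P(z)\<close>. Two facts about \<open>L\<close> are used, and the rest
  is real algebraic geometry in the plane.

  Algebraicity. A perturbation of admissible size makes \<open>P(z)\<close> singular iff
  \<open>s(z) \<le> \<epsilon> * W(cmod z)\<close>: spread a rank-one matrix, whose addition to \<open>P(z)\<close> kills a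
  minimising vector, over the coefficients, with phases that cancel those of the powers of \<open>z\<close>
  (\<open>pseudospectrum_iff\<close>). Hence \<open>L\<close> is closed, points with strict inequality are interior, and
  on the frontier \<open>\<epsilon> * W(cmod z)\<close> is a singular value of \<open>P(z)\<close>, i.e. the determinant of
  \<open>P(z)\<^sup>* P(z) - (\<epsilon> * W(cmod z))\<^sup>2\<close> vanishes. That determinant is a polynomial in
  \<open>Re z\<close>, \<open>Im z\<close> and \<open>cmod z\<close>, say \<open>A + B * cmod z\<close> after passing to its squared modulus. It does
  not vanish outside \<open>L\<close>, where every singular value is larger. Multiplying by the conjugate
  \<open>A - B * cmod z\<close> gives a polynomial in \<open>Re z\<close> and \<open>Im z\<close>, which is nonzero because
  \<open>x\<^sup>2 + y\<^sup>2\<close> is not a square (\<open>radial_poly_zeros_on_algebraic_curve\<close>).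

  Regularity. Every point of \<open>L\<close> is a limit of interior points
  (\<open>pseudospectrum_subset_closure_interior\<close>). If \<open>\<Delta>\<close> makes \<open>P + \<Delta>\<close> singular at a point, but
  not on a whole disc around it, then for
  \<open>t < 1\<close> close to \<open>1\<close> the matrix \<open>P + t \<Delta>\<close> is singular at a nearby point, by Hurwitz' theorem, and
  since \<open>t \<Delta>\<close> leaves room for further perturbation that nearby point is interior.

  Any closed plane set with these two properties has a frontier as claimed
  (\<open>algebraic_frontier_piecewise_smooth\<close>). After a shear the curve has no vertical asymptotes or
  vertical lines. Over the complement of a finite set \<open>B\<close> of abscissae it consists of
  finitely many disjoint smooth graphs: a square-free polynomial has only simple roots off the zeros
  of a resultant-like polynomial, and simple roots depend smoothly on the abscissa
  (\<open>root_branches\<close>). At the points of \<open>B\<close> the branches have limits. The frontier cannot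
  contain a proper nonempty part of a branch, since the regions on its two sides are connected and miss
  the frontier (\<open>graph_in_frontier_or_disjoint\<close>). So, apart from the finitely many points over
  \<open>B\<close>, the frontier is a union of whole branches, and as it has no isolated points, their
  closures cover it. Only points over \<open>B\<close> can be crossings or lack a tangent.\<close>

section \<open>Bivariate real polynomials\<close>

definition bieval :: "real poly poly \<Rightarrow> real \<Rightarrow> real \<Rightarrow> real" where
  "bieval p x y = poly (poly p [:y:]) x"

lemma bieval_simps [simp]:
  "bieval 0 x y = 0" "bieval 1 x y = 1"
  "bieval (p + q) x y = bieval p x y + bieval q x y"
  "bieval (p * q) x y = bieval p x y * bieval q x y"
  "bieval (- p) x y = - bieval p x y"
  "bieval (p - q) x y = bieval p x y - bieval q x y"
  "bieval (smult a p) x y = poly a x * bieval p x y"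
  "bieval [:a:] x y = poly a x"
  by (simp_all add: bieval_def)

lemma bieval_pCons: "bieval (pCons a p) x y = poly a x + y * bieval p x y"
  by (simp add: bieval_def)

lemma bieval_altdef: "bieval p x y = (\<Sum>j\<le>degree p. poly (coeff p j) x * y ^ j)"
  unfolding bieval_def poly_altdef[of p] by (simp add: poly_sum poly_const_pow mult.commute)

lemma continuous_on_bieval [continuous_intros]:
  fixes f g :: "'a::topological_space \<Rightarrow> real"
  assumes "continuous_on S f" "continuous_on S g"
  shows "continuous_on S (\<lambda>t. bieval p (f t) (g t))"
  by (induction p) (auto simp: bieval_pCons intro!: continuous_intros assms)

lemma tendsto_bieval [tendsto_intros]:
  fixes f g :: "'a \<Rightarrow> real"
  assumes "(f \<longlongrightarrow> a) F" "(g \<longlongrightarrow> b) F"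
  shows "((\<lambda>t. bieval p (f t) (g t)) \<longlongrightarrow> bieval p a b) F"
  by (induction p) (auto simp: bieval_pCons intro!: tendsto_intros assms)

text \<open>The chain rule along a graph; the coefficientwise map \<open>map_poly pderiv\<close> is the partial
  derivative in the inner variable \<open>x\<close>, and \<open>pderiv\<close> is the one in the outer variable \<open>y\<close>.\<close>

lemma DERIV_bieval:
  assumes "(g has_field_derivative g') (at t within S)"
  shows "((\<lambda>t. bieval p t (g t)) has_field_derivative
           bieval (map_poly pderiv p) t (g t) + bieval (pderiv p) t (g t) * g') (at t within S)"
proof (induction p)
  case (pCons a p)
  show ?case
    by (auto simp: bieval_pCons map_poly_pCons pderiv_pCons algebra_simps
        intro!: derivative_eq_intros pCons(2) assms)
qed auto

lemma DERIV_bieval_snd: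
  "((\<lambda>y. bieval p x y) has_field_derivative bieval (pderiv p) x y) (at y)"
proof (induction p)
  case (pCons a p)
  show ?case
    by (auto simp: bieval_pCons pderiv_pCons algebra_simps intro!: derivative_eq_intros pCons(2))
qed auto

text \<open>Restriction to the vertical line over \<open>x\<close>, as a polynomial in \<open>y\<close>, so that root orders
  can be counted line by line.\<close>

definition slice :: "real \<Rightarrow> real poly poly \<Rightarrow> real poly" where
  "slice x = map_poly (\<lambda>c. poly c x)"

lemma slice_pCons: "slice x (pCons a p) = pCons (poly a x) (slice x p)"
  by (simp add: slice_def map_poly_pCons)

lemma poly_slice [simp]: "poly (slice x p) y = bieval p x y"
  by (induction p) (simp_all add: bieval_pCons slice_pCons, simp add: slice_def)

lemma slice_hom:
  "slice x (p * q) = slice x p * slice x q" "slice x (smult a p) = smult (poly a x) (slice x p)"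
  by (simp_all flip: poly_eq_poly_eq_iff add: fun_eq_iff)

lemma slice_pderiv: "slice x (pderiv p) = pderiv (slice x p)"
  by (rule poly_eqI) (simp add: slice_def coeff_map_poly coeff_pderiv)

lemma slice_eq_0D: "slice x p = 0 \<Longrightarrow> poly (lead_coeff p) x = 0"
  by (metis slice_def coeff_map_poly coeff_0 poly_0)

section \<open>Square-free part\<close>

text \<open>A polynomial \<open>q\<close> of least degree in \<open>y\<close> with the zeros of \<open>f\<close> has only simple roots over almost
  all \<open>x\<close>. Let \<open>h\<close> be a nonzero element of least degree in the ideal generated by \<open>f\<close> and its
  \<open>y\<close>-derivative. Pseudo-division shows that \<open>h\<close> divides multiples of both by polynomials in \<open>x\<close>. If \<open>h\<close> does not
  depend on \<open>y\<close>, then \<open>f\<close> and its derivative have no common root over \<open>x\<close> unless \<open>h\<close> vanishes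
  there. Otherwise \<open>f\<close> may be replaced by its cofactor of \<open>h\<close>, which has smaller degree and, over
  almost all \<open>x\<close>, the same roots: a root of order \<open>k\<close> of \<open>f\<close> has order \<open>k - 1\<close> in the
  derivative, hence order at most \<open>k - 1\<close> in \<open>h\<close> and positive order in the cofactor.\<close>

lemma squarefree_reduction:
  fixes f :: "real poly poly"
  assumes "f \<noteq> 0"
  shows "\<exists>q d. d \<noteq> 0 \<and> (\<forall>x. poly d x \<noteq> 0 \<longrightarrow>
      (\<forall>y. bieval q x y = 0 \<longleftrightarrow> bieval f x y = 0) \<and>
      (\<forall>y. bieval q x y = 0 \<longrightarrow> bieval (pderiv q) x y \<noteq> 0))"
  using assms
proof (induction "degree f" arbitrary: f rule: less_induct)
  case less
  define I where "I = {a * f + b * pderiv f | a b. True}"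
  have fI: "f \<in> I" unfolding I_def by (rule CollectI, rule exI[of _ 1], rule exI[of _ 0]) simp
  have f'I: "pderiv f \<in> I" unfolding I_def by (rule CollectI, rule exI[of _ 0], rule exI[of _ 1]) simp
  have sub: "smult l u - h * v \<in> I" if "u \<in> I" "h \<in> I" for u h l v
  proof -
    from that obtain a b c d where "u = a * f + b * pderiv f" "h = c * f + d * pderiv f"
      unfolding I_def by blast
    hence "smult l u - h * v = (smult l a - c * v) * f + (smult l b - d * v) * pderiv f"
      by (simp add: algebra_simps smult_add_right)
    thus ?thesis unfolding I_def by blast
  qed
  define h where "h = arg_min degree (\<lambda>h. h \<in> I \<and> h \<noteq> 0)"
  have h: "h \<in> I" "h \<noteq> 0" and h_min: "\<And>u. u \<in> I \<Longrightarrow> u \<noteq> 0 \<Longrightarrow> degree h \<le> degree u"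
    using arg_min_nat_lemma[of "\<lambda>h. h \<in> I \<and> h \<noteq> 0" f degree] fI less.prems
    unfolding h_def by auto
  have dvd: "\<exists>l v. l \<noteq> 0 \<and> smult l u = h * v" if u: "u \<in> I" for u
  proof -
    obtain l v where lv: "l \<noteq> 0" "smult l u = h * v + pseudo_mod u h"
      using pseudo_mod(1)[OF h(2)] by blast
    have "pseudo_mod u h \<in> I" using sub[OF u h(1), of l v] lv by simp
    with pseudo_mod(2)[OF h(2), of u] h_min have "pseudo_mod u h = 0" by force
    with lv show ?thesis by auto
  qed
  obtain l q where l: "l \<noteq> 0" "smult l f = h * q" using dvd[OF fI] by blast
  obtain l' r where l': "l' \<noteq> 0" "smult l' (pderiv f) = h * r" using dvd[OF f'I] by blast
  show ?case
  proof (cases "degree h = 0")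
    case True
    then obtain d where d: "h = [:d:]" by (rule degree_eq_zeroE)
    obtain a b where ab: "h = a * f + b * pderiv f" using h(1) unfolding I_def by blast
    have "bieval (pderiv f) x y \<noteq> 0" if "poly d x \<noteq> 0" "bieval f x y = 0" for x y
    proof
      assume "bieval (pderiv f) x y = 0"
      hence "bieval h x y = 0" using that unfolding ab by simp
      with that d show False by simp
    qed
    moreover have "d \<noteq> 0" using d h(2) by auto
    ultimately show ?thesis by blast
  next
    case False
    have "q \<noteq> 0" using l less.prems by auto
    hence "degree f = degree h + degree q"
      using degree_mult_eq[OF h(2), of q] degree_smult_eq[of l f] l by simp
    with False \<open>q \<noteq> 0\<close> obtain s d where d: "d \<noteq> 0" "\<And>x. poly d x \<noteq> 0 \<Longrightarrow>
      (\<forall>y. bieval s x y = 0 \<longleftrightarrow> bieval q x y = 0) \<and>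
      (\<forall>y. bieval s x y = 0 \<longrightarrow> bieval (pderiv s) x y \<noteq> 0)"
      using less.hyps[of q] by auto
    have same: "bieval q x y = 0 \<longleftrightarrow> bieval f x y = 0"
      if x: "poly l x \<noteq> 0" "poly l' x \<noteq> 0" "poly (lead_coeff f) x \<noteq> 0" for x y
    proof
      have "poly l x * bieval f x y = bieval h x y * bieval q x y"
        using arg_cong[OF l(2), of "\<lambda>u. bieval u x y"] by simp
      thus "bieval q x y = 0 \<Longrightarrow> bieval f x y = 0" using x by auto
    next
      assume f0: "bieval f x y = 0"
      have fx: "slice x f \<noteq> 0" using slice_eq_0D x(3) by blast
      have 1: "smult (poly l x) (slice x f) = slice x h * slice x q"
        using arg_cong[OF l(2), of "slice x"] by (simp add: slice_hom)
      have 2: "smult (poly l' x) (pderiv (slice x f)) = slice x h * slice x r"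
        using arg_cong[OF l'(2), of "slice x"] by (simp add: slice_hom slice_pderiv)
      have o: "order y (slice x f) = Suc (order y (pderiv (slice x f)))"
        using order_pderiv[OF fx] f0 by simp
      have "pderiv (slice x f) \<noteq> 0"
      proof
        assume "pderiv (slice x f) = 0"
        then obtain c where "slice x f = [:c:]"
          by (metis degree_eq_zeroE pderiv_eq_0_iff)
        moreover have "poly (slice x f) y = 0" using f0 by simp
        ultimately show False using fx by simp
      qed
      hence "slice x h * slice x r \<noteq> 0" using 2 x by (metis smult_eq_0_iff)
      hence "order y (slice x h) \<le> order y (pderiv (slice x f))"
        using order_mult[of "slice x h" "slice x r" y] order_smult[OF x(2), of y "pderiv (slice x f)"] 2
        by simp
      moreover have "slice x h * slice x q \<noteq> 0" using 1 x fx by (metis smult_eq_0_iff)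
      hence "order y (slice x f) = order y (slice x h) + order y (slice x q)" "slice x q \<noteq> 0"
        using order_mult[of "slice x h" "slice x q" y] order_smult[OF x(1), of y "slice x f"] 1
        by auto
      ultimately have "order y (slice x q) \<noteq> 0" using o by simp
      thus "bieval q x y = 0" using order_root[of "slice x q" y] by simp
    qed
    have "d * (l * (l' * lead_coeff f)) \<noteq> 0"
      using d(1) l(1) l'(1) less.prems by simp
    with d(2) same show ?thesis
      by (intro exI[of _ s] exI[of _ "d * (l * (l' * lead_coeff f))"]) auto
  qed
qed

section \<open>Shearing into general position\<close>

text \<open>The polynomial \<open>p(X + s Y)\<close>, as a polynomial in \<open>Y\<close> over the polynomials in \<open>X\<close>.\<close>

definition shear_coeff :: "real \<Rightarrow> real poly \<Rightarrow> real poly poly" where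
  "shear_coeff s p = pcompose (map_poly (\<lambda>c. [:c:]) p) [:[:0, 1:], [:s:]:]"

lemma shear_coeff_simps:
  "shear_coeff s 0 = 0"
  "shear_coeff s (pCons a p) = [:[:a:]:] + [:[:0, 1:], [:s:]:] * shear_coeff s p"
  by (simp_all add: shear_coeff_def map_poly_pCons pcompose_pCons)

lemma bieval_shear_coeff: "bieval (shear_coeff s p) x y = poly p (x + s * y)"
  by (induction p) (auto simp: shear_coeff_simps bieval_pCons algebra_simps)

lemma shear_coeff_top:
  assumes "degree p \<le> e"
  shows "degree (shear_coeff s p) \<le> e \<and> coeff (shear_coeff s p) e = [:coeff p e * s ^ e:]"
  using assms
proof (induction p arbitrary: e)
  case 0
  show ?case by (simp add: shear_coeff_simps)
next
  case (pCons a p)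
  have IH: "degree (shear_coeff s p) \<le> e'" "coeff (shear_coeff s p) e' = [:coeff p e' * s ^ e':]"
    "coeff (shear_coeff s p) (Suc e') = 0" if "e = Suc e'" for e'
  proof -
    have "degree p \<le> e'" using pCons.prems that by (cases "p = 0") auto
    thus *: "degree (shear_coeff s p) \<le> e'" "coeff (shear_coeff s p) e' = [:coeff p e' * s ^ e':]"
      using pCons.IH by auto
    thus "coeff (shear_coeff s p) (Suc e') = 0" by (simp add: coeff_eq_0)
  qed
  have "degree (shear_coeff s (pCons a p)) \<le> e"
  proof (cases e)
    case 0
    hence "p = 0" using pCons.prems by (auto split: if_splits)
    thus ?thesis by (simp add: shear_coeff_simps)
  next
    case (Suc e')
    have "degree ([:[:0, 1:], [:s:]:] * shear_coeff s p) \<le> 1 + e'"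
      using degree_mult_le[of "[:[:0, 1:], [:s:]:]" "shear_coeff s p"] IH(1)[OF Suc]
      by (intro order.trans[OF degree_mult_le] add_mono) (auto simp: degree_pCons_eq_if)
    thus ?thesis using Suc unfolding shear_coeff_simps
      by (intro degree_add_le) auto
  qed
  moreover have "coeff (shear_coeff s (pCons a p)) e = [:coeff (pCons a p) e * s ^ e:]"
  proof (cases e)
    case 0
    hence "p = 0" using pCons.prems by (auto split: if_splits)
    thus ?thesis using 0 by (simp add: shear_coeff_simps)
  next
    case (Suc e')
    show ?thesis using IH(2,3)[OF Suc] Suc by (simp add: shear_coeff_simps algebra_simps)
  qed
  ultimately show ?case ..
qed

text \<open>If \<open>N\<close> is the total degree of \<open>f\<close>, then the coefficient of \<open>y ^ N\<close> in \<open>f(x + s y, y)\<close> is the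
  top homogeneous part of \<open>f\<close> evaluated at \<open>(s, 1)\<close>: a constant in \<open>x\<close>, and nonzero for all but finitely many \<open>s\<close>.
  A constant leading coefficient excludes vertical lines in the curve and roots
  that escape to infinity over a bounded set of \<open>x\<close>.\<close>

lemma exists_regular_shear:
  fixes f :: "real poly poly"
  assumes "f \<noteq> 0"
  obtains s F c where "\<And>x y. bieval F x y = bieval f (x + s * y) y" "c \<noteq> 0" "lead_coeff F = [:c:]"
proof -
  define N where "N = Max ((\<lambda>j. j + degree (coeff f j)) ` {j. coeff f j \<noteq> 0})"
  have fin: "finite {j. coeff f j \<noteq> 0}"
    by (rule finite_subset[of _ "{..degree f}"]) (auto intro: le_degree)
  have ne: "{j. coeff f j \<noteq> 0} \<noteq> {}" using assms by (auto simp: poly_eq_iff)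
  have N_ge: "j + degree (coeff f j) \<le> N" if "coeff f j \<noteq> 0" for j
    unfolding N_def using fin that by (intro Max_ge) auto
  have "N \<in> (\<lambda>j. j + degree (coeff f j)) ` {j. coeff f j \<noteq> 0}"
    unfolding N_def using fin ne by (intro Max_in) auto
  then obtain j0 where j0: "coeff f j0 \<noteq> 0" "N = j0 + degree (coeff f j0)" by auto
  \<comment> \<open>the top homogeneous part of \<open>f\<close> at \<open>(s, 1)\<close>, as a polynomial in \<open>s\<close>\<close>
  define top where "top = (\<Sum>j\<le>N. monom (coeff (coeff f j) (N - j)) (N - j))"
  have "coeff top (N - j0) = (\<Sum>j\<le>N. if j = j0 then coeff (coeff f j0) (N - j0) else 0)"
    unfolding top_def coeff_sum by (rule sum.cong) (use j0 in \<open>auto simp: coeff_monom\<close>)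
  also have "\<dots> = lead_coeff (coeff f j0)" using j0 by simp
  finally have "top \<noteq> 0" using j0 by force
  then obtain s where s: "poly top s \<noteq> 0" by (meson poly_all_0_iff_0)
  have zero: "coeff f j = 0" if "\<not> j \<le> N" for j using N_ge[of j] that by force
  define F where "F = (\<Sum>j\<le>N. monom 1 j * shear_coeff s (coeff f j))"
  have bF: "bieval F x y = bieval f (x + s * y) y" for x y
  proof -
    have bs: "bieval (\<Sum>j\<in>A. g j) x y = (\<Sum>j\<in>A. bieval (g j) x y)" for g and A :: "nat set"
      by (induction A rule: infinite_finite_induct) auto
    have bm: "bieval (monom 1 j) x y = y ^ j" for j
      by (simp add: bieval_def poly_monom)
    have "bieval f (x + s * y) y = (\<Sum>j\<le>N. poly (coeff f j) (x + s * y) * y ^ j)"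
      unfolding bieval_altdef by (rule sum.mono_neutral_cong) (auto simp: zero coeff_eq_0)
    thus ?thesis unfolding F_def bs by (simp add: bm bieval_shear_coeff mult.commute)
  qed
  have deg: "degree (monom 1 j * shear_coeff s (coeff f j)) \<le> N" if "j \<le> N" for j
  proof (cases "coeff f j = 0")
    case False
    have "degree (shear_coeff s (coeff f j)) \<le> N - j"
      using shear_coeff_top[of "coeff f j" "N - j" s] N_ge[OF False] by simp
    thus ?thesis using degree_mult_le[of "monom 1 j" "shear_coeff s (coeff f j)"] that
      by (simp add: degree_monom_eq)
  qed (simp add: shear_coeff_simps)
  have cN: "coeff (monom 1 j * shear_coeff s (coeff f j)) N = [:coeff (coeff f j) (N - j) * s ^ (N - j):]"
    if "j \<le> N" for j
  proof (cases "coeff f j = 0")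
    case False
    show ?thesis using shear_coeff_top[of "coeff f j" "N - j" s] N_ge[OF False] that
      by (simp add: coeff_monom_mult)
  qed (simp add: shear_coeff_simps)
  have "coeff F N = (\<Sum>j\<le>N. [:coeff (coeff f j) (N - j) * s ^ (N - j):])"
    unfolding F_def coeff_sum by (rule sum.cong) (use cN in auto)
  also have "\<dots> = [:poly top s:]"
    unfolding top_def by (simp add: sum_to_poly poly_sum poly_monom)
  finally have cF: "coeff F N = [:poly top s:]" .
  have "degree F \<le> N" unfolding F_def using deg by (intro degree_sum_le) auto
  hence "degree F = N" using cF s by (intro antisym le_degree) auto
  with bF cF s show ?thesis using that[of F s "poly top s"] by simp
qed

text \<open>A root \<open>y\<close> with \<open>\<bar>y\<bar> > 1\<close> satisfies
  \<open>\<bar>c\<bar> * \<bar>y\<bar> ^ n \<le> (sum of the other coefficients) * \<bar>y\<bar> ^ (n - 1)\<close>. The bound is continuous in \<open>x\<close>.\<close>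

lemma bounded_roots:
  fixes F :: "real poly poly"
  assumes "lead_coeff F = [:c:]" "c \<noteq> 0" "bieval F x y = 0"
  shows "\<bar>y\<bar> \<le> 1 + (\<Sum>j<degree F. \<bar>poly (coeff F j) x\<bar>) / \<bar>c\<bar>"
proof (cases "\<bar>y\<bar> \<le> 1")
  case True
  thus ?thesis by (meson abs_ge_zero add_increasing2 divide_nonneg_nonneg sum_nonneg)
next
  case False
  hence y: "\<bar>y\<bar> > 1" by simp
  let ?n = "degree F" let ?S = "\<Sum>j<degree F. \<bar>poly (coeff F j) x\<bar>"
  have "?n \<noteq> 0" 
  proof
    assume "?n = 0"
    hence "F = [:[:c:]:]" using assms(1) by (metis degree_eq_zeroE lead_coeff_pCons(2))
    thus False using assms by simp
  qed
  have "bieval F x y = (\<Sum>j\<le>?n. poly (coeff F j) x * y ^ j)" by (rule bieval_altdef)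
  also have "{..?n} = insert ?n {..<?n}" by auto
  finally have "c * y ^ ?n = - (\<Sum>j<?n. poly (coeff F j) x * y ^ j)" using assms by simp
  hence "\<bar>c\<bar> * \<bar>y\<bar> ^ ?n = \<bar>\<Sum>j<?n. poly (coeff F j) x * y ^ j\<bar>"
    by (metis abs_minus_cancel abs_mult power_abs)
  also have "\<dots> \<le> (\<Sum>j<?n. \<bar>poly (coeff F j) x * y ^ j\<bar>)" by (rule sum_abs)
  also have "\<dots> \<le> (\<Sum>j<?n. \<bar>poly (coeff F j) x\<bar> * \<bar>y\<bar> ^ (?n - 1))"
    by (intro sum_mono) (use y in \<open>auto simp: abs_mult power_abs intro!: mult_left_mono power_increasing\<close>)
  also have "\<dots> = ?S * \<bar>y\<bar> ^ (?n - 1)" by (simp add: sum_distrib_right)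
  also have "\<bar>c\<bar> * \<bar>y\<bar> ^ ?n = \<bar>c\<bar> * \<bar>y\<bar> * \<bar>y\<bar> ^ (?n - 1)"
    using \<open>?n \<noteq> 0\<close> by (simp add: power_eq_if)
  finally have "\<bar>c\<bar> * \<bar>y\<bar> \<le> ?S"
    by (rule mult_right_le_imp_le) (use y in auto)
  hence "\<bar>y\<bar> \<le> ?S / \<bar>c\<bar>" using assms by (simp add: field_simps)
  thus ?thesis by simp
qed

section \<open>Real roots as functions of a parameter\<close>

lemma bieval_nonzero_near:
  assumes "bieval p x0 y0 \<noteq> 0"
  shows "\<exists>r>0. \<forall>x y. \<bar>x - x0\<bar> < r \<longrightarrow> \<bar>y - y0\<bar> < r \<longrightarrow> bieval p x y \<noteq> 0"
proof -
  have "open {z :: real \<times> real. bieval p (fst z) (snd z) \<noteq> 0}"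
    by (intro open_Collect_neq continuous_intros)
  moreover have "(x0, y0) \<in> {z. bieval p (fst z) (snd z) \<noteq> 0}" using assms by simp
  ultimately obtain X Y where XY: "open X" "open Y" "(x0, y0) \<in> X \<times> Y"
    "X \<times> Y \<subseteq> {z. bieval p (fst z) (snd z) \<noteq> 0}" by (rule open_prod_elim)
  obtain a b where "a > 0" "ball x0 a \<subseteq> X" "b > 0" "ball y0 b \<subseteq> Y"
    using XY by (meson SigmaD1 SigmaD2 open_contains_ball)
  with XY(4) show ?thesis
    by (intro exI[of _ "min a b"]) (force simp: ball_def dist_real_def subset_iff abs_minus_commute)
qed

lemma simple_root_sign_change:
  fixes f :: "real \<Rightarrow> real"
  assumes "(f has_field_derivative d) (at y)" "d \<noteq> 0" "f y = 0" "e > 0"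
  obtains h where "0 < h" "h < e" "f (y - h) * f (y + h) < 0"
proof -
  have pos: "\<exists>h. 0 < h \<and> h < e \<and> g (y - h) * g (y + h) < 0"
    if g: "(g has_field_derivative c) (at y)" "c > 0" "g y = 0" for g :: "real \<Rightarrow> real" and c
  proof -
    obtain a where a: "a > 0" "\<forall>h>0. h < a \<longrightarrow> g y < g (y + h)"
      using DERIV_pos_inc_right[OF g(1,2)] by auto
    obtain b where b: "b > 0" "\<forall>h>0. h < b \<longrightarrow> g (y - h) < g y"
      using DERIV_pos_inc_left[OF g(1,2)] by auto
    obtain h where "0 < h" "h < min e (min a b)" using a b \<open>e > 0\<close> dense[of 0 "min e (min a b)"] by auto
    thus ?thesis using a b g(3) by (intro exI[of _ h]) (auto intro!: mult_neg_pos)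
  qed
  show ?thesis
  proof (cases "d > 0")
    case True
    thus ?thesis using pos[OF assms(1)] assms that by blast
  next
    case False
    have "((\<lambda>t. - f t) has_field_derivative - d) (at y)" using assms by (auto intro: derivative_eq_intros)
    thus ?thesis using pos[of "\<lambda>t. - f t" "-d"] False assms that by auto
  qed
qed

lemma sign_change_imp_root:
  fixes f :: "real \<Rightarrow> real"
  assumes "continuous_on {a..b} f" "a \<le> b" "f a * f b < 0"
  shows "\<exists>y. a \<le> y \<and> y \<le> b \<and> f y = 0"
  using IVT'[of f a 0 b] IVT2'[of f b 0 a] assms by (fastforce simp: mult_less_0_iff)

text \<open>At a simple root the polynomial changes sign, and the sign change survives a small change of the
  abscissa, so a root remains nearby. It is the only one because a second one would, by Rolle, force
  a zero of the \<open>y\<close>-derivative near the simple root.\<close>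

lemma simple_root_persists:
  assumes "bieval q x0 y0 = 0" "bieval (pderiv q) x0 y0 \<noteq> 0"
  shows "\<forall>\<^sub>F e in at_right 0. \<forall>\<^sub>F x in nhds x0. \<exists>!y. \<bar>y - y0\<bar> < e \<and> bieval q x y = 0"
proof -
  obtain r where r: "r > 0"
    "\<And>x y. \<bar>x - x0\<bar> < r \<Longrightarrow> \<bar>y - y0\<bar> < r \<Longrightarrow> bieval (pderiv q) x y \<noteq> 0"
    using bieval_nonzero_near[OF assms(2)] by blast
  have "\<forall>\<^sub>F x in nhds x0. \<exists>!y. \<bar>y - y0\<bar> < e \<and> bieval q x y = 0" if e: "0 < e" "e < r" for e
  proof -
    obtain h where h: "0 < h" "h < e" "bieval q x0 (y0 - h) * bieval q x0 (y0 + h) < 0"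
      using simple_root_sign_change[OF DERIV_bieval_snd assms(2,1) e(1)] by blast
    have "((\<lambda>x. bieval q x (y0 - h) * bieval q x (y0 + h)) \<longlongrightarrow>
             bieval q x0 (y0 - h) * bieval q x0 (y0 + h)) (nhds x0)"
      by (intro tendsto_intros filterlim_ident)
    hence "\<forall>\<^sub>F x in nhds x0. bieval q x (y0 - h) * bieval q x (y0 + h) < 0"
      using h(3) by (rule order_tendstoD)
    moreover have "\<forall>\<^sub>F x in nhds x0. \<bar>x - x0\<bar> < r"
      using eventually_nhds_in_open[of "ball x0 r" x0] r(1)
      by (auto simp: dist_real_def abs_minus_commute)
    ultimately show ?thesis
    proof eventually_elim
      case (elim x)
      obtain y where y: "y0 - h \<le> y" "y \<le> y0 + h" "bieval q x y = 0"
        using sign_change_imp_root[of "y0 - h" "y0 + h" "bieval q x",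
            OF continuous_on_bieval[OF continuous_on_const continuous_on_id]] elim h by auto
      have no: False if less: "y1 < y2" and "\<bar>y1 - y0\<bar> < e" "\<bar>y2 - y0\<bar> < e" "bieval q x y1 = 0" "bieval q x y2 = 0" for y1 y2
      proof -
        obtain z where z: "y1 < z" "z < y2" "bieval q x y2 - bieval q x y1 = (y2 - y1) * bieval (pderiv q) x z"
          using MVT2[OF less, of "bieval q x" "bieval (pderiv q) x"] DERIV_bieval_snd by blast
        hence "bieval (pderiv q) x z = 0" using that by simp
        thus False using r(2)[of x z] elim z that e by auto
      qed
      show ?case
      proof (rule ex1I[of _ y])
        show y': "\<bar>y - y0\<bar> < e \<and> bieval q x y = 0" using y h by auto
        fix u assume "\<bar>u - y0\<bar> < e \<and> bieval q x u = 0"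
        thus "u = y" using no[of u y] no[of y u] y' by (cases u y rule: linorder_cases) auto
      qed
    qed
  qed
  thus ?thesis using r(1) by (auto simp: eventually_at_right_field intro!: exI[of _ r])
qed

definition roots_at :: "real poly poly \<Rightarrow> real \<Rightarrow> real set" where
  "roots_at F x = {y. bieval F x y = 0}"

lemma finite_roots_at:
  assumes "lead_coeff F = [:c:]" "c \<noteq> 0"
  shows "finite (roots_at F x)"
proof -
  have "slice x F \<noteq> 0" using slice_eq_0D[of x F] assms by auto
  thus ?thesis using poly_roots_finite[of "slice x F"] by (simp add: roots_at_def)
qed

lemma compact_roots_over_interval:
  assumes "lead_coeff F = [:c:]" "c \<noteq> 0"
  shows "compact {z :: real \<times> real. fst z \<in> {a..b} \<and> bieval F (fst z) (snd z) = 0}"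
proof -
  let ?M = "\<lambda>x. 1 + (\<Sum>j<degree F. \<bar>poly (coeff F j) x\<bar>) / \<bar>c\<bar>"
  have "compact (?M ` {a..b})"
    using assms(2) by (intro compact_continuous_image continuous_intros) auto
  then obtain C where C: "\<And>x. x \<in> {a..b} \<Longrightarrow> ?M x \<le> C"
    by (meson bounded_imp_bdd_above bdd_above.E compact_imp_bounded imageI)
  have "{z :: real \<times> real. fst z \<in> {a..b} \<and> bieval F (fst z) (snd z) = 0}
      = ({a..b} \<times> {-C..C}) \<inter> {z. bieval F (fst z) (snd z) = 0}"
    using bounded_roots[OF assms] C by (fastforce simp: abs_le_iff)
  moreover have "closed {z :: real \<times> real. bieval F (fst z) (snd z) = 0}"
    by (intro closed_Collect_eq continuous_intros)
  ultimately show ?thesis by (simp add: compact_Int_closed compact_Times)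
qed

text \<open>New roots cannot come out of nowhere: the part of the curve over a compact interval
  is compact, so the abscissae of its points at distance at least \<open>e\<close> from all roots over \<open>x0\<close>
  form a closed set, and \<open>x0\<close> is not in it.\<close>

lemma roots_do_not_appear:
  assumes "lead_coeff F = [:c:]" "c \<noteq> 0" "e > 0"
  shows "\<forall>\<^sub>F x in nhds x0. \<forall>y\<in>roots_at F x. \<exists>y0\<in>roots_at F x0. \<bar>y - y0\<bar> < e"
proof -
  let ?Z = "{z :: real \<times> real. fst z \<in> {x0 - 1..x0 + 1} \<and> bieval F (fst z) (snd z) = 0}"
  let ?C = "?Z \<inter> {z. \<forall>y0\<in>roots_at F x0. e \<le> \<bar>snd z - y0\<bar>}"
  have "closed {z :: real \<times> real. \<forall>y0\<in>roots_at F x0. e \<le> \<bar>snd z - y0\<bar>}"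
    unfolding Ball_def by (intro closed_Collect_all closed_Collect_imp closed_Collect_le continuous_intros) auto
  hence "compact (fst ` ?C)"
    using compact_roots_over_interval[OF assms(1,2)]
    by (intro compact_continuous_image compact_Int_closed continuous_intros)
  hence "open (- (fst ` ?C))" by (simp add: compact_imp_closed open_Compl)
  moreover have "x0 \<notin> fst ` ?C" using assms(3) by (auto simp: roots_at_def)
  ultimately have "\<forall>\<^sub>F x in nhds x0. x \<notin> fst ` ?C"
    using eventually_nhds_in_open[of "- (fst ` ?C)" x0] by simp
  moreover have "\<forall>\<^sub>F x in nhds x0. x \<in> {x0 - 1<..<x0 + 1}"
    by (rule eventually_nhds_in_open) auto
  ultimately show ?thesis
  proof eventually_elim
    case (elim x)
    show ?case
    proof (rule ballI, rule ccontr)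
      fix y assume y: "y \<in> roots_at F x" "\<not> (\<exists>y0\<in>roots_at F x0. \<bar>y - y0\<bar> < e)"
      hence "(x, y) \<in> ?C" using elim(2) by (auto simp: roots_at_def not_less)
      with elim(1) show False by (metis (no_types, lifting) fst_conv image_eqI)
    qed
  qed
qed

definition root_list :: "real poly poly \<Rightarrow> real \<Rightarrow> real list" where
  "root_list F x = sorted_list_of_set (roots_at F x)"

text \<open>Where all roots are simple, each one persists as exactly one root nearby and no others appear, so
  the roots over \<open>x0\<close> and over a nearby \<open>x\<close> correspond bijectively. Once the displacement is less
  than half the gaps, the correspondence preserves the order: the number of roots is locally
  constant and the \<open>i\<close>-th root is continuous.\<close>

lemma root_list_locally_continuous:
  assumes F: "lead_coeff F = [:c:]" "c \<noteq> 0"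
    and same: "\<forall>\<^sub>F x in nhds x0. roots_at q x = roots_at F x"
    and simple: "\<And>y. y \<in> roots_at F x0 \<Longrightarrow> bieval (pderiv q) x0 y \<noteq> 0"
    and e: "e > 0"
  shows "\<forall>\<^sub>F x in nhds x0. length (root_list F x) = length (root_list F x0) \<and>
           (\<forall>i<length (root_list F x0). \<bar>root_list F x ! i - root_list F x0 ! i\<bar> < e)"
proof -
  let ?R = "roots_at F x0"
  have fin: "finite ?R" by (rule finite_roots_at[OF F])
  have R_eq: "roots_at q x0 = ?R" using same by (rule eventually_nhds_x_imp_x)
  have "\<forall>\<^sub>F d in at_right 0. \<forall>y\<in>?R. \<forall>\<^sub>F x in nhds x0. \<exists>!u. \<bar>u - y\<bar> < d \<and> bieval q x u = 0"
    using simple_root_persists[of q x0] simple R_eq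
    by (intro eventually_ball_finite[OF fin]) (auto simp: roots_at_def)
  moreover have "\<forall>\<^sub>F d in at_right 0. \<forall>y\<in>?R. \<forall>y'\<in>?R. y \<noteq> y' \<longrightarrow> 2 * d < \<bar>y - y'\<bar>"
  proof (intro eventually_ball_finite[OF fin] ballI)
    fix y y' :: real
    show "\<forall>\<^sub>F d in at_right 0. y \<noteq> y' \<longrightarrow> 2 * d < \<bar>y - y'\<bar>"
    proof (cases "y = y'")
      case False
      hence "\<bar>y - y'\<bar> / 2 > 0" by simp
      thus ?thesis by (auto simp: eventually_at_right_field intro!: exI[of _ "\<bar>y - y'\<bar> / 2"])
    qed simp
  qed
  moreover have "\<forall>\<^sub>F d in at_right 0. 0 < d \<and> d < e"
    using e by (auto simp: eventually_at_right_field intro!: exI[of _ e])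
  ultimately have "\<forall>\<^sub>F d in at_right 0. (\<forall>y\<in>?R. \<forall>\<^sub>F x in nhds x0. \<exists>!u. \<bar>u - y\<bar> < d \<and> bieval q x u = 0) \<and>
     (\<forall>y\<in>?R. \<forall>y'\<in>?R. y \<noteq> y' \<longrightarrow> 2 * d < \<bar>y - y'\<bar>) \<and> 0 < d \<and> d < e"
    by eventually_elim auto
  then obtain d where d: "\<forall>y\<in>?R. \<forall>\<^sub>F x in nhds x0. \<exists>!u. \<bar>u - y\<bar> < d \<and> bieval q x u = 0"
     "\<forall>y\<in>?R. \<forall>y'\<in>?R. y \<noteq> y' \<longrightarrow> 2 * d < \<bar>y - y'\<bar>" "0 < d" "d < e"
    using eventually_happens'[OF trivial_limit_at_right_real] by blast
  have "\<forall>\<^sub>F x in nhds x0. \<forall>y\<in>?R. \<exists>!u. \<bar>u - y\<bar> < d \<and> bieval q x u = 0"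
    using d(1) by (rule eventually_ball_finite[OF fin])
  with same roots_do_not_appear[OF F d(3)] show ?thesis
  proof eventually_elim
    case (elim x)
    define g where "g y = (THE u. \<bar>u - y\<bar> < d \<and> bieval q x u = 0)" for y
    have g: "\<bar>g y - y\<bar> < d" "g y \<in> roots_at F x" if "y \<in> ?R" for y
      using theI'[of "\<lambda>u. \<bar>u - y\<bar> < d \<and> bieval q x u = 0"] elim(1,3) that
      unfolding g_def by (auto simp: roots_at_def)
    have "roots_at F x \<subseteq> g ` ?R"
    proof
      fix u assume u: "u \<in> roots_at F x"
      then obtain y where y: "y \<in> ?R" "\<bar>u - y\<bar> < d" using elim(2) by blast
      moreover have "bieval q x u = 0" using u elim(1) by (auto simp: roots_at_def)
      ultimately have "g y = u" unfolding g_def by (intro the1_equality) (use elim(3) in auto)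
      with y show "u \<in> g ` ?R" by blast
    qed
    hence im: "g ` ?R = roots_at F x" using g by blast
    have mono: "g y < g y'" if "y \<in> ?R" "y' \<in> ?R" "y < y'" for y y'
      using g(1)[OF that(1)] g(1)[OF that(2)] d(2) that by fastforce
    have "inj_on g ?R" by (rule linorder_inj_onI) (use mono in \<open>auto simp: order_less_imp_not_eq\<close>)
    hence "length (map g (root_list F x0)) = card (roots_at F x)"
      using im card_image by (fastforce simp: root_list_def)
    moreover have "sorted_wrt (<) (map g (root_list F x0))"
      using strict_sorted_list_of_set[of ?R] fin mono unfolding sorted_wrt_map root_list_def
      by (elim sorted_wrt_mono_rel[rotated]) auto
    moreover have "set (map g (root_list F x0)) = roots_at F x"
      using im fin by (simp add: root_list_def)
    ultimately have eq: "root_list F x = map g (root_list F x0)"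
      using sorted_list_of_set_unique[OF finite_roots_at[OF F], of "map g (root_list F x0)" x]
      unfolding root_list_def by metis
    moreover have "root_list F x0 ! i \<in> ?R" if "i < length (root_list F x0)" for i
      using nth_mem[OF that] fin by (simp add: root_list_def)
    ultimately show ?case using g(1) d(4) by force
  qed
qed

text \<open>The implicit function theorem for a branch already known to be continuous: with
  \<open>y0 = \<rho> x0\<close>, the difference \<open>q(x, \<rho> x) - q(x0, y0) = 0\<close> is split at \<open>(x, y0)\<close>, and the mean
  value theorem is applied to the vertical part.\<close>

lemma DERIV_implicit:
  assumes J: "open J" "x0 \<in> J" and cont: "continuous_on J \<rho>"
    and zero: "\<And>x. x \<in> J \<Longrightarrow> bieval q x (\<rho> x) = 0"
    and nz: "bieval (pderiv q) x0 (\<rho> x0) \<noteq> 0"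
  shows "(\<rho> has_field_derivative
     - bieval (map_poly pderiv q) x0 (\<rho> x0) / bieval (pderiv q) x0 (\<rho> x0)) (at x0)"
proof -
  have "\<exists>\<eta>. \<bar>\<eta> - \<rho> x0\<bar> \<le> \<bar>\<rho> x - \<rho> x0\<bar> \<and>
     bieval q x (\<rho> x) - bieval q x (\<rho> x0) = (\<rho> x - \<rho> x0) * bieval (pderiv q) x \<eta>" for x
  proof (cases "\<rho> x" "\<rho> x0" rule: linorder_cases)
    case less
    from MVT2[OF this, of "bieval q x" "bieval (pderiv q) x"] DERIV_bieval_snd
    obtain z where "\<rho> x < z" "z < \<rho> x0"
      "bieval q x (\<rho> x0) - bieval q x (\<rho> x) = (\<rho> x0 - \<rho> x) * bieval (pderiv q) x z" by blast
    thus ?thesis by (intro exI[of _ z]) (auto simp: algebra_simps)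
  next
    case greater
    from MVT2[OF this, of "bieval q x" "bieval (pderiv q) x"] DERIV_bieval_snd
    obtain z where "\<rho> x0 < z" "z < \<rho> x"
      "bieval q x (\<rho> x) - bieval q x (\<rho> x0) = (\<rho> x - \<rho> x0) * bieval (pderiv q) x z" by blast
    thus ?thesis by (intro exI[of _ z]) auto
  qed (auto intro: exI[of _ "\<rho> x0"])
  then obtain \<eta> where \<eta>: "\<And>x. \<bar>\<eta> x - \<rho> x0\<bar> \<le> \<bar>\<rho> x - \<rho> x0\<bar>"
    "\<And>x. bieval q x (\<rho> x) - bieval q x (\<rho> x0) = (\<rho> x - \<rho> x0) * bieval (pderiv q) x (\<eta> x)" by metis
  have "(\<rho> \<longlongrightarrow> \<rho> x0) (at x0)"
    using cont J by (simp add: continuous_on_eq_continuous_at isContD)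
  hence "((\<lambda>x. \<bar>\<rho> x - \<rho> x0\<bar>) \<longlongrightarrow> 0) (at x0)" using LIM_zero tendsto_rabs_zero by blast
  hence "((\<lambda>x. \<eta> x - \<rho> x0) \<longlongrightarrow> 0) (at x0)"
    by (rule Lim_null_comparison[rotated]) (use \<eta>(1) in auto)
  hence lim: "(\<eta> \<longlongrightarrow> \<rho> x0) (at x0)" by (rule LIM_zero_cancel)
  have den: "((\<lambda>x. bieval (pderiv q) x (\<eta> x)) \<longlongrightarrow> bieval (pderiv q) x0 (\<rho> x0)) (at x0)"
    using lim by (intro tendsto_intros)
  have "((\<lambda>x. bieval q x (\<rho> x0)) has_field_derivative bieval (map_poly pderiv q) x0 (\<rho> x0)) (at x0)"
    using DERIV_bieval[of "\<lambda>_. \<rho> x0" 0 x0 UNIV q] by simp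
  hence num: "((\<lambda>x. (bieval q x (\<rho> x0) - bieval q x0 (\<rho> x0)) / (x - x0)) \<longlongrightarrow>
      bieval (map_poly pderiv q) x0 (\<rho> x0)) (at x0)"
    by (simp add: has_field_derivative_iff)
  have "((\<lambda>x. - ((bieval q x (\<rho> x0) - bieval q x0 (\<rho> x0)) / (x - x0)) / bieval (pderiv q) x (\<eta> x)) \<longlongrightarrow>
      - bieval (map_poly pderiv q) x0 (\<rho> x0) / bieval (pderiv q) x0 (\<rho> x0)) (at x0)"
    by (intro tendsto_intros num den nz)
  moreover have "\<forall>\<^sub>F x in at x0. - ((bieval q x (\<rho> x0) - bieval q x0 (\<rho> x0)) / (x - x0)) / bieval (pderiv q) x (\<eta> x)
      = (\<rho> x - \<rho> x0) / (x - x0)"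
    using tendsto_imp_eventually_ne[OF den nz] eventually_at_in_open'[OF J]
  proof eventually_elim
    case (elim x)
    have "bieval q x (\<rho> x0) = - (\<rho> x - \<rho> x0) * bieval (pderiv q) x (\<eta> x)"
      using \<eta>(2)[of x] zero[OF elim(2)] by (simp add: algebra_simps)
    hence "bieval q x (\<rho> x0) / bieval (pderiv q) x (\<eta> x) = - (\<rho> x - \<rho> x0)"
      using elim(1) by (simp add: field_simps)
    moreover have "- ((bieval q x (\<rho> x0) - bieval q x0 (\<rho> x0)) / (x - x0)) / bieval (pderiv q) x (\<eta> x)
        = - (bieval q x (\<rho> x0) / bieval (pderiv q) x (\<eta> x)) / (x - x0)"
      using zero[OF J(2)] by simp
    ultimately show ?case by simp
  qed
  ultimately show ?thesis
    unfolding has_field_derivative_iff by (rule Lim_transform_eventually)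
qed

text \<open>By the quotient rule, the functions \<open>N(x, \<rho> x) / q\<^sub>y(x, \<rho> x) ^ e\<close> with polynomial \<open>N\<close>
  form a class that contains \<open>\<rho>\<close> and is closed under differentiation.\<close>

lemma implicit_smooth:
  assumes J: "open J" and cont: "continuous_on J \<rho>"
    and zero: "\<And>x. x \<in> J \<Longrightarrow> bieval q x (\<rho> x) = 0"
    and nz: "\<And>x. x \<in> J \<Longrightarrow> bieval (pderiv q) x (\<rho> x) \<noteq> 0"
  shows "\<exists>D :: nat \<Rightarrow> real \<Rightarrow> real. D 0 = \<rho> \<and>
     (\<forall>k. \<forall>x\<in>J. (D k has_field_derivative D (Suc k) x) (at x))"
proof -
  let ?p = "pderiv q" and ?qx = "map_poly pderiv q"
  define C where "C = {\<lambda>x. bieval N x (\<rho> x) / bieval ?p x (\<rho> x) ^ e | N e. True}"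
  have "\<rho> = (\<lambda>x. bieval [:0, 1:] x (\<rho> x) / bieval ?p x (\<rho> x) ^ 0)"
    by (simp add: bieval_def)
  hence "\<rho> \<in> C" unfolding C_def by blast
  have step: "\<exists>f'\<in>C. \<forall>x\<in>J. (f has_field_derivative f' x) (at x)" if "f \<in> C" for f
  proof -
    obtain N e where f: "f = (\<lambda>x. bieval N x (\<rho> x) / bieval ?p x (\<rho> x) ^ e)"
      using \<open>f \<in> C\<close> unfolding C_def by blast
    \<comment> \<open>numerator of the derivative of \<open>N / q\<^sub>y ^ e\<close> over the denominator \<open>q\<^sub>y ^ (e + 2)\<close>,
      after inserting \<open>\<rho>' = - q\<^sub>x / q\<^sub>y\<close>\<close>
    define N' where "N' = (map_poly pderiv N * ?p - pderiv N * ?qx) * ?p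
        - smult [:of_nat e:] (N * (map_poly pderiv ?p * ?p - pderiv ?p * ?qx))"
    have "(f has_field_derivative bieval N' x (\<rho> x) / bieval ?p x (\<rho> x) ^ (e + 2)) (at x)" if x: "x \<in> J" for x
    proof -
      let ?u = "bieval ?p x (\<rho> x)"
      have u: "?u \<noteq> 0" using nz x by blast
      have "(\<rho> has_field_derivative - bieval ?qx x (\<rho> x) / ?u) (at x)"
        by (rule DERIV_implicit[OF J x cont]) (use zero nz x in auto)
      note d = DERIV_bieval[OF this]
      have e1: "?u ^ e \<noteq> 0" using u by simp
      have quotient: "((A + B * (- Q / v)) * v ^ e - M * (real e * ((A' + B' * (- Q / v)) * v ^ (e - Suc 0))))
            / (v ^ e * v ^ e)
          = ((A * v - B * Q) * v - real e * (M * (A' * v - B' * Q))) / v ^ (e + 2)"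
        if "v \<noteq> 0" for A B A' B' Q M v :: real
      proof (cases e)
        case (Suc k)
        have "v ^ k \<noteq> 0" using that by simp
        thus ?thesis using that unfolding Suc by (simp add: divide_simps) algebra
      qed (use that in \<open>simp add: divide_simps power2_eq_square; algebra\<close>)
      note D = DERIV_divide[OF d[of N] DERIV_power[OF d[of ?p], of e] e1]
      show ?thesis unfolding f
        by (rule DERIV_cong[OF D]) (rule trans[OF quotient[OF u]], simp add: N'_def)
    qed
    moreover have "(\<lambda>x. bieval N' x (\<rho> x) / bieval ?p x (\<rho> x) ^ (e + 2)) \<in> C"
      unfolding C_def by (intro CollectI exI[of _ N'] exI[of _ "e + 2"] conjI refl TrueI)
    ultimately show ?thesis by (intro bexI[where x = "\<lambda>x. bieval N' x (\<rho> x) / bieval ?p x (\<rho> x) ^ (e + 2)"] ballI)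
  qed
  have "\<exists>D. \<forall>k. (D k \<in> C \<and> (k = 0 \<longrightarrow> D k = \<rho>)) \<and> (\<forall>x\<in>J. (D k has_field_derivative D (Suc k) x) (at x))"
    by (rule dependent_nat_choice) (use \<open>\<rho> \<in> C\<close> step in auto)
  thus ?thesis by blast
qed

text \<open>Compactness provides one limit value \<open>L\<close> along some sequence; it is a root over \<open>b\<close>. The branch
  cannot oscillate away from it: choose \<open>d\<close> small such that \<open>L + d\<close> and \<open>L - d\<close> are not roots over \<open>b\<close>.
  Then they are not roots over any \<open>x\<close> near \<open>b\<close> either, so \<open>\<bar>\<rho> x - L\<bar>\<close> never equals \<open>d\<close> there, and
  by connectedness it stays below \<open>d\<close>.\<close>

lemma branch_has_limit:
  assumes F: "lead_coeff F = [:c:]" "c \<noteq> 0"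
    and J: "convex J" "b \<in> closure J" and cont: "continuous_on J \<rho>"
    and zero: "\<And>x. x \<in> J \<Longrightarrow> bieval F x (\<rho> x) = 0"
  shows "\<exists>L. (\<rho> \<longlongrightarrow> L) (at b within J)"
proof -
  let ?Z = "{z :: real \<times> real. fst z \<in> {b - 1..b + 1} \<and> bieval F (fst z) (snd z) = 0}"
  obtain u where u: "\<And>n. u n \<in> J" "u \<longlonglongrightarrow> b" using J(2) by (auto simp: closure_sequential)
  have "\<forall>\<^sub>F n in sequentially. u n \<in> {b - 1<..<b + 1}"
    by (rule topological_tendstoD[OF u(2)]) auto
  then obtain n0 where n0: "\<And>n. n \<ge> n0 \<Longrightarrow> u n \<in> {b - 1<..<b + 1}"
    by (auto simp: eventually_sequentially)
  define v where "v n = u (n + n0)" for n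
  have v: "\<And>n. v n \<in> J" "\<And>n. v n \<in> {b - 1<..<b + 1}" "v \<longlonglongrightarrow> b"
    using u n0 LIMSEQ_ignore_initial_segment[OF u(2), of n0] by (auto simp: v_def[abs_def])
  have "\<forall>n. (v n, \<rho> (v n)) \<in> ?Z" using v zero by (auto simp: less_imp_le)
  then obtain l r where l: "l \<in> ?Z" "strict_mono r" "((\<lambda>n. (v n, \<rho> (v n))) \<circ> r) \<longlonglongrightarrow> l"
    using compact_roots_over_interval[OF F, of "b - 1" "b + 1"]
    unfolding compact_eq_seq_compact_metric seq_compact_def by meson
  have "(\<lambda>n. v (r n)) \<longlonglongrightarrow> fst l" using tendsto_fst[OF l(3)] by (simp add: o_def)
  moreover have vr: "(\<lambda>n. v (r n)) \<longlonglongrightarrow> b" using LIMSEQ_subseq_LIMSEQ[OF v(3) l(2)] by (simp add: o_def)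
  ultimately have "fst l = b" using LIMSEQ_unique by blast
  define L where "L = snd l"
  have \<rho>L: "(\<lambda>n. \<rho> (v (r n))) \<longlonglongrightarrow> L" using tendsto_snd[OF l(3)] by (simp add: o_def L_def)
  have "(\<rho> \<longlongrightarrow> L) (at b within J)"
  proof (rule tendstoI)
    fix e :: real assume "e > 0"
    have "\<exists>d. 0 < d \<and> d < e \<and> L + d \<notin> roots_at F b \<and> L - d \<notin> roots_at F b"
    proof (rule ccontr)
      assume "\<not> ?thesis"
      hence "{0<..<e} \<subseteq> (\<lambda>y. y - L) ` roots_at F b \<union> (\<lambda>y. L - y) ` roots_at F b"
        by (force simp: image_iff algebra_simps)
      hence "finite {0<..<e}" using finite_roots_at[OF F, of b] finite_subset by blast
      thus False using \<open>e > 0\<close> infinite_Ioo by blast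
    qed
    then obtain d where d: "0 < d" "d < e" "bieval F b (L + d) \<noteq> 0" "bieval F b (L - d) \<noteq> 0"
      by (auto simp: roots_at_def)
    have "((\<lambda>x. bieval F x (L + d) * bieval F x (L - d)) \<longlongrightarrow> bieval F b (L + d) * bieval F b (L - d)) (nhds b)"
      by (intro tendsto_intros filterlim_ident)
    hence "\<forall>\<^sub>F x in nhds b. bieval F x (L + d) * bieval F x (L - d) \<noteq> 0"
      by (rule tendsto_imp_eventually_ne) (use d in simp)
    then obtain s where s: "s > 0" "\<And>x. dist x b < s \<Longrightarrow> bieval F x (L + d) * bieval F x (L - d) \<noteq> 0"
      unfolding eventually_nhds_metric by blast
    let ?S = "J \<inter> ball b s"
    have conn: "connected ((\<lambda>x. \<bar>\<rho> x - L\<bar>) ` ?S)"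
      using J(1) by (intro connected_continuous_image continuous_intros continuous_on_subset[OF cont]
          convex_connected convex_Int) auto
    have miss: "d \<notin> (\<lambda>x. \<bar>\<rho> x - L\<bar>) ` ?S"
    proof
      assume "d \<in> (\<lambda>x. \<bar>\<rho> x - L\<bar>) ` ?S"
      then obtain x where x: "x \<in> J" "dist x b < s" "\<rho> x = L + d \<or> \<rho> x = L - d"
        by (auto simp: dist_commute abs_if split: if_splits)
      thus False using zero[OF x(1)] s(2)[OF x(2)] by auto
    qed
    have start: "\<exists>x\<in>?S. \<bar>\<rho> x - L\<bar> < d"
    proof -
      have "\<forall>\<^sub>F n in sequentially. dist (v (r n)) b < s" by (rule tendstoD[OF vr s(1)])
      moreover have "\<forall>\<^sub>F n in sequentially. dist (\<rho> (v (r n))) L < d" by (rule tendstoD[OF \<rho>L d(1)])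
      ultimately have "\<forall>\<^sub>F n in sequentially. dist (v (r n)) b < s \<and> dist (\<rho> (v (r n))) L < d"
        by eventually_elim auto
      then obtain n where "dist (v (r n)) b < s \<and> dist (\<rho> (v (r n))) L < d"
        using eventually_happens'[OF sequentially_bot] by blast
      thus ?thesis using v(1)[of "r n"] by (intro bexI[of _ "v (r n)"]) (auto simp: dist_commute dist_real_def)
    qed
    have small: "\<bar>\<rho> x - L\<bar> < d" if "x \<in> ?S" for x
    proof (rule ccontr)
      assume "\<not> \<bar>\<rho> x - L\<bar> < d"
      moreover obtain x' where "x' \<in> ?S" "\<bar>\<rho> x' - L\<bar> < d" using start by blast
      ultimately have "d \<in> (\<lambda>x. \<bar>\<rho> x - L\<bar>) ` ?S"
        using conn that by (intro connectedD_interval[OF conn imageI[of x'] imageI[of x]]) auto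
      with miss show False ..
    qed
    have "\<forall>\<^sub>F x in at b within J. x \<in> J \<inter> ball b s"
      using eventually_at[of "\<lambda>x. x \<in> J \<inter> ball b s" b J] s(1) by (auto simp: dist_commute)
    thus "\<forall>\<^sub>F x in at b within J. dist (\<rho> x) L < e"
      by eventually_elim (use small d in \<open>force simp: dist_real_def\<close>)
  qed
  thus ?thesis ..
qed

section \<open>Branches of a plane algebraic curve\<close>

lemma component_Compl_finite:
  fixes B :: "real set"
  assumes "finite B" "J \<in> components (- B)"
  shows "open J" "convex J" "J \<noteq> {}" "closure J - J \<subseteq> B" "J \<inter> B = {}"
proof -
  show o: "open J" by (rule open_components[OF _ assms(2)]) (simp add: assms finite_imp_closed open_Compl)
  show "convex J" using in_components_connected[OF assms(2)] by (simp add: is_interval_connected_1 flip: is_interval_convex_1)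
  show "J \<noteq> {}" by (rule in_components_nonempty[OF assms(2)])
  show "J \<inter> B = {}" using in_components_subset[OF assms(2)] by blast
  have "frontier J \<subseteq> B"
    by (rule frontier_of_components_closed_complement[OF _ assms(2)]) (simp add: assms finite_imp_closed)
  thus "closure J - J \<subseteq> B" using o by (simp add: frontier_def interior_open)
qed

text \<open>A component is determined by the set of points of \<open>B\<close> to its left, because any point of \<open>B\<close>
  between two components is to the left of exactly one of them.\<close>

lemma finite_components_Compl_finite:
  fixes B :: "real set"
  assumes "finite B"
  shows "finite (components (- B))"
proof (rule inj_on_finite[of "\<lambda>J. {b\<in>B. \<forall>x\<in>J. b < x}" _ "Pow B"])
  have le: "J = J'" if JJ: "J \<in> components (- B)" "J' \<in> components (- B)"
     and eq: "{b\<in>B. \<forall>x\<in>J. b < x} = {b\<in>B. \<forall>x\<in>J'. b < x}" and x: "x \<in> J" "y \<in> J'" "x \<le> y" for J J' x y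
  proof -
    have "{x..y} \<inter> B = {}"
    proof (rule ccontr)
      assume "{x..y} \<inter> B \<noteq> {}"
      then obtain b where b: "b \<in> B" "x \<le> b" "b \<le> y" by auto
      have "b < u" if u: "u \<in> J'" for u
      proof (rule ccontr)
        assume "\<not> b < u"
        hence "b \<in> J'" using component_Compl_finite(2)[OF assms JJ(2)] u x b
          by (meson is_interval_convex_1 mem_is_interval_1_I not_less)
        thus False using component_Compl_finite(5)[OF assms JJ(2)] b by blast
      qed
      with eq b have "\<forall>u\<in>J. b < u" by blast
      with x b show False by force
    qed
    hence "{x..y} \<subseteq> - B" by blast
    moreover have "x \<in> J \<inter> {x..y}" "y \<in> J' \<inter> {x..y}" using x by simp_all
    ultimately have "{x..y} \<subseteq> J" "{x..y} \<subseteq> J'"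
      using components_maximal[OF JJ(1), of "{x..y}"] components_maximal[OF JJ(2), of "{x..y}"]
      by (metis connected_Icc empty_iff)+
    thus ?thesis using components_nonoverlap[OF JJ] x by auto
  qed
  show "inj_on (\<lambda>J. {b\<in>B. \<forall>x\<in>J. b < x}) (components (- B))"
  proof (rule inj_onI)
    fix J J' assume J: "J \<in> components (- B)" "J' \<in> components (- B)"
      "{b\<in>B. \<forall>x\<in>J. b < x} = {b\<in>B. \<forall>x\<in>J'. b < x}"
    obtain x y where xy: "x \<in> J" "y \<in> J'" using in_components_nonempty J by blast
    show "J = J'"
    proof (cases "x \<le> y")
      case True
      thus ?thesis using le[OF J xy] by simp
    next
      case False
      thus ?thesis using le[OF J(2,1) J(3)[symmetric] xy(2,1)] by simp
    qed
  qed
qed (use assms in auto)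

text \<open>The structure of a plane algebraic curve in sheared coordinates: over each of the finitely many
  intervals that make up the complement of \<open>B\<close>, the curve consists of \<open>n J\<close> strictly ordered smooth
  graphs, continuous up to the end points of \<open>J\<close>. The set \<open>B\<close> collects the abscissae over which
  multiple roots may occur.\<close>

lemma root_branches:
  fixes f :: "real poly poly"
  assumes "f \<noteq> 0"
  obtains s :: real and B :: "real set" and n :: "real set \<Rightarrow> nat"
    and \<phi> :: "real set \<Rightarrow> nat \<Rightarrow> real \<Rightarrow> real"
  where "finite B"
    "\<And>b. finite {y. bieval f (b + s * y) y = 0}"
    "\<And>J i. J \<in> components (- B) \<Longrightarrow> i < n J \<Longrightarrow> continuous_on (closure J) (\<phi> J i)"
    "\<And>J i. J \<in> components (- B) \<Longrightarrow> i < n J \<Longrightarrow> \<exists>D :: nat \<Rightarrow> real \<Rightarrow> real. D 0 = \<phi> J i \<and>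
        (\<forall>k. \<forall>x\<in>J. (D k has_field_derivative D (Suc k) x) (at x))"
    "\<And>J i j x. J \<in> components (- B) \<Longrightarrow> i < j \<Longrightarrow> j < n J \<Longrightarrow> x \<in> J \<Longrightarrow> \<phi> J i x < \<phi> J j x"
    "\<And>J x y. J \<in> components (- B) \<Longrightarrow> x \<in> J \<Longrightarrow>
        bieval f (x + s * y) y = 0 \<longleftrightarrow> (\<exists>i<n J. y = \<phi> J i x)"
proof -
  obtain s F c where F: "\<And>x y. bieval F x y = bieval f (x + s * y) y" "c \<noteq> 0" "lead_coeff F = [:c:]"
    by (rule exists_regular_shear[OF assms]) (rule that; assumption)
  note Fc = F(3,2)
  have "F \<noteq> 0" using F by auto
  from squarefree_reduction[OF this] obtain q d where qd: "d \<noteq> 0"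
    "\<And>x y. poly d x \<noteq> 0 \<Longrightarrow> bieval q x y = 0 \<longleftrightarrow> bieval F x y = 0"
    "\<And>x y. poly d x \<noteq> 0 \<Longrightarrow> bieval q x y = 0 \<Longrightarrow> bieval (pderiv q) x y \<noteq> 0"
    by metis
  have d: "d \<noteq> 0" "\<And>x. poly d x \<noteq> 0 \<Longrightarrow> roots_at q x = roots_at F x"
    "\<And>x y. poly d x \<noteq> 0 \<Longrightarrow> y \<in> roots_at F x \<Longrightarrow> bieval (pderiv q) x y \<noteq> 0"
    using qd by (auto simp: roots_at_def)
  define B where "B = {x. poly d x = 0}"
  have B: "finite B" unfolding B_def using d(1) by (rule poly_roots_finite)
  note comp = component_Compl_finite[OF B]
  define n where "n J = length (root_list F (SOME x. x \<in> J))" for J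
  \<comment> \<open>on \<open>J\<close> the \<open>i\<close>-th root from below, at the end points of \<open>J\<close> its limit\<close>
  define \<phi> where "\<phi> J i x = (if x \<in> J then root_list F x ! i else Lim (at x within J) (\<lambda>x. root_list F x ! i))"
    for J i x
  have near: "\<forall>\<^sub>F x in nhds x0. length (root_list F x) = length (root_list F x0) \<and>
           (\<forall>i<length (root_list F x0). \<bar>root_list F x ! i - root_list F x0 ! i\<bar> < e)"
    if x0: "x0 \<in> J" and J: "J \<in> components (- B)" and e: "e > 0" for x0 J e
  proof (rule root_list_locally_continuous[OF Fc _ _ e])
    have "\<forall>\<^sub>F x in nhds x0. x \<in> J" using comp(1)[OF J] x0 by (rule eventually_nhds_in_open)
    thus "\<forall>\<^sub>F x in nhds x0. roots_at q x = roots_at F x"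
      by eventually_elim (use comp(5)[OF J] d(2) in \<open>auto simp: B_def\<close>)
    show "\<And>y. y \<in> roots_at F x0 \<Longrightarrow> bieval (pderiv q) x0 y \<noteq> 0"
      using comp(5)[OF J] x0 d(3) by (auto simp: B_def)
  qed
  have len: "length (root_list F x) = n J" if J: "J \<in> components (- B)" and x: "x \<in> J" for x J
  proof -
    have "(SOME x. x \<in> J) \<in> J" using x by (rule someI)
    moreover have "\<forall>a\<in>J. \<forall>\<^sub>F b in at a within J. length (root_list F a) = length (root_list F b)"
    proof
      fix a assume "a \<in> J"
      hence "\<forall>\<^sub>F b in nhds a. length (root_list F a) = length (root_list F b)"
        by (intro eventually_mono[OF near[OF _ J zero_less_one]]) auto
      thus "\<forall>\<^sub>F b in at a within J. length (root_list F a) = length (root_list F b)"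
        by (auto simp: eventually_at_filter elim: eventually_mono)
    qed
    ultimately show ?thesis unfolding n_def
      by (rule connected_local_const[OF in_components_connected[OF J] x])
  qed
  have cont: "continuous_on J (\<lambda>x. root_list F x ! i)" if J: "J \<in> components (- B)" and i: "i < n J" for J i
    unfolding continuous_on_def
  proof
    fix a assume a: "a \<in> J"
    show "((\<lambda>x. root_list F x ! i) \<longlongrightarrow> root_list F a ! i) (at a within J)"
    proof (rule tendstoI)
      fix e :: real assume "e > 0"
      hence "\<forall>\<^sub>F x in nhds a. dist (root_list F x ! i) (root_list F a ! i) < e"
        by (intro eventually_mono[OF near[OF a J]]) (use len[OF J a] i in \<open>auto simp: dist_real_def\<close>)
      thus "\<forall>\<^sub>F x in at a within J. dist (root_list F x ! i) (root_list F a ! i) < e"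
        by (auto simp: eventually_at_filter elim: eventually_mono)
    qed
  qed
  have mem: "root_list F x ! i \<in> roots_at F x" if "J \<in> components (- B)" "x \<in> J" "i < n J" for J x i
    using nth_mem[of i "root_list F x"] len[OF that(1,2)] that(3) finite_roots_at[OF Fc, of x]
    by (simp add: root_list_def)
  show ?thesis
  proof (rule that[of B s n \<phi>])
    show "finite B" by fact
    show "finite {y. bieval f (b + s * y) y = 0}" for b
      using finite_roots_at[OF Fc, of b] by (simp add: roots_at_def F)
  next
    fix J i assume J: "J \<in> components (- B)" and i: "i < n J"
    let ?\<rho> = "\<lambda>x. root_list F x ! i"
    show "continuous_on (closure J) (\<phi> J i)"
      unfolding continuous_on_def
    proof
      fix b assume b: "b \<in> closure J"
      have "finite (closure J - J - {b})" using comp(4)[OF J] B finite_subset by blast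
      hence "open (- (closure J - J - {b}))" by (intro open_Compl finite_imp_closed)
      hence *: "at b within closure J = at b within J"
        by (rule at_within_nhd[rotated]) (use closure_subset[of J] in auto)
      have "(?\<rho> \<longlongrightarrow> \<phi> J i b) (at b within J)"
      proof (cases "b \<in> J")
        case True
        thus ?thesis using cont[OF J i] by (simp add: \<phi>_def continuous_on_def)
      next
        case False
        obtain L where L: "(?\<rho> \<longlongrightarrow> L) (at b within J)"
          using branch_has_limit[OF Fc comp(2)[OF J] b cont[OF J i]] mem[OF J] i
          by (auto simp: roots_at_def)
        have "at b within J \<noteq> bot"
          using b False by (simp add: at_within_eq_bot_iff)
        hence "Lim (at b within J) ?\<rho> = L" using L tendsto_Lim by blast
        thus ?thesis using L False by (simp add: \<phi>_def)
      qed
      moreover have "\<forall>\<^sub>F x in at b within J. ?\<rho> x = \<phi> J i x"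
        by (simp add: eventually_at_filter \<phi>_def)
      ultimately show "(\<phi> J i \<longlongrightarrow> \<phi> J i b) (at b within closure J)"
        unfolding * by (rule Lim_transform_eventually)
    qed
    obtain D :: "nat \<Rightarrow> real \<Rightarrow> real" where D: "D 0 = ?\<rho>"
      "\<And>k x. x \<in> J \<Longrightarrow> (D k has_field_derivative D (Suc k) x) (at x)"
      using implicit_smooth[OF comp(1)[OF J] cont[OF J i], of q] mem[OF J _ i] d(2,3) comp(5)[OF J]
      by (fastforce simp: roots_at_def B_def)
    define D' where "D' k = (if k = 0 then \<phi> J i else D k)" for k
    have "(D' k has_field_derivative D' (Suc k) x) (at x)" if x: "x \<in> J" for k x
    proof (cases "k = 0")
      case True
      have "(\<phi> J i has_field_derivative D (Suc 0) x) (at x)"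
        by (rule has_field_derivative_transform_within_open[OF _ comp(1)[OF J] x])
          (use D(2)[OF x, of 0] D(1) in \<open>auto simp: \<phi>_def\<close>)
      thus ?thesis using True by (simp add: D'_def)
    next
      case False
      thus ?thesis using D(2)[OF x] by (simp add: D'_def)
    qed
    thus "\<exists>D :: nat \<Rightarrow> real \<Rightarrow> real. D 0 = \<phi> J i \<and>
        (\<forall>k. \<forall>x\<in>J. (D k has_field_derivative D (Suc k) x) (at x))"
      by (intro exI[of _ D']) (simp add: D'_def)
  next
    fix J i j x assume J: "J \<in> components (- B)" "i < j" "j < n J" "x \<in> J"
    have "sorted_wrt (<) (root_list F x)" unfolding root_list_def by (rule strict_sorted_list_of_set)
    thus "\<phi> J i x < \<phi> J j x"
      using J len[OF J(1,4)] by (simp add: \<phi>_def sorted_wrt_iff_nth_less)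
  next
    fix J x y assume J: "J \<in> components (- B)" "x \<in> J"
    have "y \<in> roots_at F x \<longleftrightarrow> y \<in> set (root_list F x)"
      using finite_roots_at[OF Fc] by (simp add: root_list_def)
    thus "bieval f (x + s * y) y = 0 \<longleftrightarrow> (\<exists>i<n J. y = \<phi> J i x)"
      using J len[OF J] by (auto simp: in_set_conv_nth \<phi>_def roots_at_def F)
  qed
qed

section \<open>Sheared coordinates\<close>

text \<open>The point with abscissa \<open>x\<close> and ordinate \<open>y\<close> in the coordinates whose second axis is spanned by \<open>s + \<i>\<close>;
  \<open>(shear_coord s z, Im z)\<close> are the coordinates of \<open>z\<close>.\<close>

definition shear_point :: "real \<Rightarrow> real \<Rightarrow> real \<Rightarrow> complex" where
  "shear_point s x y = of_real x + of_real y * Complex s 1"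

definition shear_coord :: "real \<Rightarrow> complex \<Rightarrow> real" where
  "shear_coord s z = Re z - s * Im z"

lemma shear_point_simps [simp]:
  "Re (shear_point s x y) = x + s * y" "Im (shear_point s x y) = y"
  "shear_coord s (shear_point s x y) = x"
  "shear_point s (shear_coord s z) (Im z) = z"
  by (simp_all add: shear_point_def shear_coord_def complex_eq_iff)

lemma continuous_shear [continuous_intros]:
  "continuous_on S f \<Longrightarrow> continuous_on S g \<Longrightarrow> continuous_on S (\<lambda>t. shear_point s (f t) (g t))"
  "continuous_on S h \<Longrightarrow> continuous_on S (\<lambda>t. shear_coord s (h t))"
  unfolding shear_point_def shear_coord_def by (intro continuous_intros; assumption)+

lemma tendsto_shear [tendsto_intros]:
  "(f \<longlongrightarrow> a) F \<Longrightarrow> (g \<longlongrightarrow> b) F \<Longrightarrow> ((\<lambda>t. shear_point s (f t) (g t)) \<longlongrightarrow> shear_point s a b) F"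
  "(h \<longlongrightarrow> c) F \<Longrightarrow> ((\<lambda>t. shear_coord s (h t)) \<longlongrightarrow> shear_coord s c) F"
  unfolding shear_point_def shear_coord_def by (intro tendsto_intros; assumption)+

definition tube :: "real \<Rightarrow> real set \<Rightarrow> (real \<Rightarrow> real) \<Rightarrow> (real \<Rightarrow> real) \<Rightarrow> complex set" where
  "tube s J lo hi = {z. shear_coord s z \<in> J \<and> lo (shear_coord s z) < Im z \<and> Im z < hi (shear_coord s z)}"

lemma open_tube:
  assumes "open J" "continuous_on J lo" "continuous_on J hi"
  shows "open (tube s J lo hi)"
proof -
  have o: "open {z. shear_coord s z \<in> J}"
    using continuous_open_preimage[of UNIV "shear_coord s" J] assms(1)
      continuous_shear(2)[OF continuous_on_id, of UNIV s] by (simp add: vimage_def)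
  let ?U = "{z. shear_coord s z \<in> J}"
  have c: "continuous_on ?U (\<lambda>z. lo (shear_coord s z))" "continuous_on ?U (\<lambda>z. hi (shear_coord s z))"
    by (rule continuous_on_compose2[OF assms(2)] continuous_on_compose2[OF assms(3)]; 
        auto intro!: continuous_intros)+
  have "open (?U \<inter> (\<lambda>z. Im z - lo (shear_coord s z)) -` {0<..})"
       "open (?U \<inter> (\<lambda>z. hi (shear_coord s z) - Im z) -` {0<..})"
    using o c by (intro continuous_open_preimage continuous_intros open_greaterThan; simp)+
  hence "open ((?U \<inter> (\<lambda>z. Im z - lo (shear_coord s z)) -` {0<..}) \<inter> (?U \<inter> (\<lambda>z. hi (shear_coord s z) - Im z) -` {0<..}))"
    by (rule open_Int)
  also have "\<dots> = tube s J lo hi" by (auto simp: tube_def)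
  finally show ?thesis .
qed

text \<open>The region is the image of \<open>J \<times> (0, 1)\<close> under affine interpolation between the two graphs, and
  the two graphs themselves are the values at \<open>0\<close> and \<open>1\<close>.\<close>

lemma tube_connected_and_adherent:
  assumes "connected J" "continuous_on J lo" "continuous_on J hi" "\<And>x. x \<in> J \<Longrightarrow> lo x < hi x"
  shows "connected (tube s J lo hi)"
    and "\<And>x. x \<in> J \<Longrightarrow> shear_point s x (lo x) \<in> closure (tube s J lo hi)"
    and "\<And>x. x \<in> J \<Longrightarrow> shear_point s x (hi x) \<in> closure (tube s J lo hi)"
proof -
  let ?h = "\<lambda>x t. shear_point s x (lo x + t * (hi x - lo x))"
  let ?f = "\<lambda>p. ?h (fst p) (snd p)"
  have mem: "?h x t \<in> tube s J lo hi" if "x \<in> J" "0 < t" "t < 1" for x t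
  proof -
    define w where "w = hi x - lo x"
    have "t * w < w" using that assms(4)[OF that(1)] by (simp add: w_def)
    hence "lo x + t * w < hi x" by (simp add: w_def)
    moreover have "0 < t * w" using that assms(4)[OF that(1)] by (simp add: w_def)
    ultimately show ?thesis using that by (simp add: tube_def flip: w_def)
  qed
  have "tube s J lo hi = ?f ` (J \<times> {0<..<1})"
  proof
    show "?f ` (J \<times> {0<..<1}) \<subseteq> tube s J lo hi" using mem by auto
    show "tube s J lo hi \<subseteq> ?f ` (J \<times> {0<..<1})"
    proof
      fix z assume z: "z \<in> tube s J lo hi"
      let ?x = "shear_coord s z"
      let ?t = "(Im z - lo ?x) / (hi ?x - lo ?x)"
      have "z = ?f (?x, ?t)" using z by (simp add: tube_def)
      moreover have "(?x, ?t) \<in> J \<times> {0<..<1}" using z by (simp add: tube_def)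
      ultimately show "z \<in> ?f ` (J \<times> {0<..<1})" by (rule image_eqI)
    qed
  qed
  moreover have cf: "continuous_on (J \<times> {0<..<1}) ?f"
  proof -
    have "continuous_on (J \<times> {0<..<1::real}) (\<lambda>p. lo (fst p))"
      "continuous_on (J \<times> {0<..<1::real}) (\<lambda>p. hi (fst p))"
      by (rule continuous_on_compose2[OF assms(2)] continuous_on_compose2[OF assms(3)];
          auto intro: continuous_on_fst)+
    thus ?thesis by (intro continuous_intros)
  qed
  moreover have "connected (J \<times> {0<..<1::real})"
    using assms(1) by (intro connected_Times) auto
  ultimately show "connected (tube s J lo hi)"
    using connected_continuous_image[OF cf] by simp
  fix x assume x: "x \<in> J"
  have "?h x ` closure {0<..<1::real} \<subseteq> closure (tube s J lo hi)"
    by (rule image_closure_subset) (use mem[OF x] in \<open>auto intro!: continuous_intros subsetD[OF closure_subset]\<close>)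
  from subsetD[OF this imageI[of 0]] subsetD[OF this imageI[of 1]]
  show "shear_point s x (lo x) \<in> closure (tube s J lo hi)"
    "shear_point s x (hi x) \<in> closure (tube s J lo hi)" by simp_all
qed

section \<open>Graphs in the frontier of a plane set\<close>

text \<open>Suppose that near a graph the frontier of \<open>L\<close> lies on that graph. The regions below and above are
  connected and miss the frontier, so each lies in \<open>L\<close> or in its complement. If one is inside and
  the other outside, every point of the graph is adherent to both. If both are inside, then so is the graph,
  \<open>L\<close> being closed, and its points are interior. If both are outside, a point of the graph in \<open>L\<close>
  would be a limit of interior points of \<open>L\<close>, which is impossible because \<open>L\<close> is then nearby contained in
  the graph. This last case is where the density of interior points is needed.\<close>

lemma graph_in_frontier_or_disjoint:
  fixes L :: "complex set"
  assumes L: "closed L" "L \<subseteq> closure (interior L)"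
    and J: "open J" "connected J"
    and cont: "continuous_on J lo" "continuous_on J \<phi>" "continuous_on J hi"
    and less: "\<And>x. x \<in> J \<Longrightarrow> lo x < \<phi> x" "\<And>x. x \<in> J \<Longrightarrow> \<phi> x < hi x"
    and only: "\<And>z. z \<in> tube s J lo hi \<Longrightarrow> z \<in> frontier L \<Longrightarrow> Im z = \<phi> (shear_coord s z)"
  shows "(\<forall>x\<in>J. shear_point s x (\<phi> x) \<in> frontier L) \<or> (\<forall>x\<in>J. shear_point s x (\<phi> x) \<notin> frontier L)"
proof -
  let ?D = "tube s J lo \<phi>" and ?U = "tube s J \<phi> hi" and ?T = "tube s J lo hi"
  let ?g = "\<lambda>x. shear_point s x (\<phi> x)"
  have D: "connected ?D" "\<And>x. x \<in> J \<Longrightarrow> ?g x \<in> closure ?D"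
    using tube_connected_and_adherent[OF J(2) cont(1,2) less(1)] by auto
  have U: "connected ?U" "\<And>x. x \<in> J \<Longrightarrow> ?g x \<in> closure ?U"
    using tube_connected_and_adherent[OF J(2) cont(2,3) less(2)] by auto
  have T: "open ?T" by (rule open_tube[OF J(1) cont(1,3)])
  have sub: "?D \<subseteq> ?T" "?U \<subseteq> ?T" using less by (force simp: tube_def)+
  have T_split: "z \<in> ?D \<or> z \<in> ?U \<or> (shear_coord s z \<in> J \<and> z = ?g (shear_coord s z))" if "z \<in> ?T" for z
    using that by (auto simp: tube_def shear_point_def shear_coord_def complex_eq_iff)
  have gT: "?g x \<in> ?T" if "x \<in> J" for x using that less by (simp add: tube_def)
  have side: "W \<subseteq> L \<or> W \<subseteq> - L" if "connected W" "W \<inter> frontier L = {}" for W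
    using connected_Int_frontier[OF that(1), of L] that(2) by blast
  have nD: "?D \<inter> frontier L = {}" using only sub(1) by (fastforce simp: tube_def)
  have nU: "?U \<inter> frontier L = {}" using only sub(2) by (fastforce simp: tube_def)
  from side[OF D(1) nD] side[OF U(1) nU]
  consider "?D \<subseteq> L" "?U \<subseteq> L" | "?D \<subseteq> - L" "?U \<subseteq> - L" | "?D \<subseteq> L" "?U \<subseteq> - L" | "?D \<subseteq> - L" "?U \<subseteq> L"
    by blast
  thus ?thesis
  proof cases
    case 1
    have "?g x \<in> L" if "x \<in> J" for x
      using U(2)[OF that] closure_minimal[OF 1(2) L(1)] by blast
    hence "?T \<subseteq> L" using 1 T_split by (metis subsetD subsetI)
    hence "?T \<subseteq> interior L" using T by (rule interior_maximal)
    thus ?thesis using gT by (auto simp: frontier_def)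
  next
    case 2
    have "?g x \<notin> L" if x: "x \<in> J" for x
    proof
      assume "?g x \<in> L"
      hence "?g x \<in> closure (interior L)" using L(2) by blast
      then obtain z where z: "z \<in> ?T" "z \<in> interior L"
        using gT[OF x] open_Int_closure_eq_empty[OF T, of "interior L"] by blast
      hence "z \<in> L" using interior_subset by blast
      hence z': "shear_coord s z \<in> J" "z = ?g (shear_coord s z)" using T_split[OF z(1)] 2 by auto
      hence "z \<in> closure ?U" using U(2) by metis
      hence "interior L \<inter> ?U \<noteq> {}"
        using z(2) open_Int_closure_eq_empty[OF open_interior, of L ?U] by blast
      thus False using 2(2) interior_subset[of L] by blast
    qed
    thus ?thesis using L(1) by (auto simp: frontier_def)
  next
    case 3
    hence "?g x \<in> frontier L" if "x \<in> J" for x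
      using D(2)[OF that] U(2)[OF that] closure_mono[OF 3(1)] closure_mono[OF 3(2)]
      unfolding frontier_closures by blast
    thus ?thesis by blast
  next
    case 4
    hence "?g x \<in> frontier L" if "x \<in> J" for x
      using D(2)[OF that] U(2)[OF that] closure_mono[OF 4(1)] closure_mono[OF 4(2)]
      unfolding frontier_closures by blast
    thus ?thesis by blast
  qed
qed

text \<open>A punctured disc around an isolated frontier point is connected and misses the frontier. If it lies in \<open>L\<close>, then the
  centre is interior to \<open>L\<close>; if it misses \<open>L\<close>, then the centre is an isolated point of \<open>L\<close> and not a
  limit of interior points.\<close>

lemma frontier_no_isolated_points:
  fixes L :: "complex set"
  assumes L: "closed L" "L \<subseteq> closure (interior L)" and z: "z \<in> frontier L"
  shows "z islimpt frontier L"
proof (rule ccontr)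
  assume "\<not> z islimpt frontier L"
  then obtain r where r: "r > 0" "\<forall>w\<in>frontier L. w \<noteq> z \<longrightarrow> \<not> dist w z < r"
    unfolding islimpt_approachable by blast
  let ?A = "ball z r - {z}"
  have zL: "z \<in> L" using z L(1) by (auto simp: frontier_def)
  have "?A \<inter> frontier L = {}" using r(2) by (auto simp: dist_commute)
  moreover have "connected ?A" by (rule connected_punctured_ball) simp
  ultimately consider "?A \<inter> L = {}" | "?A \<subseteq> L" using connected_Int_frontier[of ?A L] by blast
  thus False
  proof cases
    case 1
    have "z \<in> closure (interior L)" using zL L(2) by blast
    moreover have "z \<in> ball z r" using r(1) by simp
    ultimately have "ball z r \<inter> interior L \<noteq> {}"
      using open_Int_closure_eq_empty[OF open_ball, of z r "interior L"] by blast
    moreover have "ball z r \<inter> interior L \<subseteq> {z}" using 1 interior_subset[of L] by blast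
    ultimately have "ball z r \<inter> interior L = {z}" by blast
    moreover have "open (ball z r \<inter> interior L)" by (intro open_Int open_ball open_interior)
    ultimately show False using not_open_singleton by metis
  next
    case 2
    hence "ball z r \<subseteq> L" using zL by blast
    hence "z \<in> interior L" using r(1) interior_maximal[of "ball z r" L] by auto
    thus False using z by (simp add: frontier_def)
  qed
qed

text \<open>Near \<open>x0\<close> the set \<open>S\<close> is the graph, so secants of \<open>S\<close> are secants of the graph. With the slope
  function \<open>g\<close> of Caratheodory's form of the derivative, the secant to abscissa \<open>x\<close> is
  \<open>(x - x0) *\<^sub>R shear_point s 1 (g x)\<close>, a real multiple of a vector
  that tends to the tangent vector \<open>shear_point s 1 d\<close>.\<close>

lemma graph_has_tangent:
  assumes J: "open J" "x0 \<in> J" and d: "(\<phi> has_field_derivative d) (at x0)"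
    and in_S: "\<And>x. x \<in> J \<Longrightarrow> shear_point s x (\<phi> x) \<in> S"
    and T: "open T" "shear_point s x0 (\<phi> x0) \<in> T"
    and only: "\<And>z. z \<in> S \<Longrightarrow> z \<in> T \<Longrightarrow> Im z = \<phi> (shear_coord s z)"
  shows "has_tangent S (shear_point s x0 (\<phi> x0))"
proof -
  let ?z = "shear_point s x0 (\<phi> x0)"
  define u where "u = shear_point s 1 d"
  obtain g where g: "\<And>x. \<phi> x - \<phi> x0 = g x * (x - x0)" "isCont g x0" "g x0 = d"
    using d unfolding CARAT_DERIV by blast
  have diff: "shear_point s x (\<phi> x) - ?z = (x - x0) *\<^sub>R shear_point s 1 (g x)" for x
  proof -
    have "\<phi> x = \<phi> x0 + g x * (x - x0)" using g(1)[of x] by simp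
    thus ?thesis by (simp add: complex_eq_iff) (simp add: algebra_simps)
  qed
  have "u \<noteq> 0"
  proof
    assume "u = 0"
    hence "Re u = 0" "Im u = 0" by simp_all
    thus False by (simp add: u_def)
  qed
  moreover have "tangent_cone S ?z = span {u}"
  proof
    show "tangent_cone S ?z \<subseteq> span {u}"
    proof
      fix v assume "v \<in> tangent_cone S ?z"
      then obtain x t where xt: "\<And>k::nat. x k \<in> S" "\<And>k. t k > 0" "t \<longlonglongrightarrow> 0"
        "(\<lambda>k. (x k - ?z) /\<^sub>R t k) \<longlonglongrightarrow> v" unfolding tangent_cone_def by blast
      have "(\<lambda>k. ?z + t k *\<^sub>R ((x k - ?z) /\<^sub>R t k)) \<longlonglongrightarrow> ?z + 0 *\<^sub>R v"
        by (intro tendsto_intros xt)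
      moreover have "?z + t k *\<^sub>R ((x k - ?z) /\<^sub>R t k) = x k" for k
        using xt(2)[of k] by simp
      ultimately have xz: "x \<longlonglongrightarrow> ?z" by simp
      define a where "a k = shear_coord s (x k)" for k
      have a: "a \<longlonglongrightarrow> x0"
        using tendsto_shear(2)[OF xz, of s] by (simp add: a_def[abs_def])
      have ga: "(\<lambda>k. g (a k)) \<longlonglongrightarrow> d" using isCont_tendsto_compose[OF g(2) a] g(3) by simp
      have "\<forall>\<^sub>F k in sequentially. x k \<in> T" using topological_tendstoD[OF xz T] .
      hence ev: "\<forall>\<^sub>F k in sequentially.
          shear_coord s ((x k - ?z) /\<^sub>R t k) *\<^sub>R shear_point s 1 (g (a k)) = (x k - ?z) /\<^sub>R t k"
      proof eventually_elim
        case (elim k)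
        have "x k = shear_point s (a k) (\<phi> (a k))"
          using only[OF xt(1) elim] shear_point_simps(4)[of s "x k"] unfolding a_def by metis
        hence "x k - ?z = (a k - x0) *\<^sub>R shear_point s 1 (g (a k))" using diff by metis
        moreover have "shear_coord s ((x k - ?z) /\<^sub>R t k) = (a k - x0) / t k"
        proof -
          have "shear_coord s ((x k - ?z) /\<^sub>R t k) = (shear_coord s (x k) - shear_coord s ?z) / t k"
            unfolding shear_coord_def by (simp add: divide_simps) (simp add: algebra_simps)
          thus ?thesis by (simp add: a_def)
        qed
        ultimately show ?case by (simp add: divide_inverse mult.commute)
      qed
      have "(\<lambda>k. shear_coord s ((x k - ?z) /\<^sub>R t k) *\<^sub>R shear_point s 1 (g (a k)))
           \<longlonglongrightarrow> shear_coord s v *\<^sub>R u"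
        unfolding u_def by (intro tendsto_intros xt ga)
      with ev have "(\<lambda>k. (x k - ?z) /\<^sub>R t k) \<longlonglongrightarrow> shear_coord s v *\<^sub>R u"
        by (rule Lim_transform_eventually[rotated])
      hence "v = shear_coord s v *\<^sub>R u" using xt(4) LIMSEQ_unique by blast
      thus "v \<in> span {u}" by (metis span_base span_scale singletonI)
    qed
    show "span {u} \<subseteq> tangent_cone S ?z"
    proof
      fix v assume "v \<in> span {u}"
      then obtain c where v: "v = c *\<^sub>R u" by (auto simp: span_singleton)
      obtain \<delta> where \<delta>: "\<delta> > 0" "\<And>x. \<bar>x - x0\<bar> < \<delta> \<Longrightarrow> x \<in> J"
        using J by (metis open_real)
      \<comment> \<open>scaled so that \<open>x0 + c * t k\<close> stays in \<open>J\<close> for every \<open>k\<close>\<close>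
      define t where "t k = \<delta> / (\<bar>c\<bar> + 1) * inverse (real (Suc k))" for k
      have t: "t k > 0" for k unfolding t_def using \<delta> by (intro mult_pos_pos divide_pos_pos) auto
      have "(\<lambda>k. \<delta> / (\<bar>c\<bar> + 1) * inverse (real (Suc k))) \<longlonglongrightarrow> \<delta> / (\<bar>c\<bar> + 1) * 0"
        by (intro tendsto_intros LIMSEQ_inverse_real_of_nat)
      hence t0: "t \<longlonglongrightarrow> 0" by (simp add: t_def[abs_def])
      define y where "y k = x0 + c * t k" for k
      have "\<bar>y k - x0\<bar> < \<delta>" for k
      proof -
        have "\<bar>y k - x0\<bar> = \<bar>c\<bar> * t k" using t[of k] by (simp add: y_def abs_mult)
        also have "\<dots> < (\<bar>c\<bar> + 1) * t k" using t[of k] by (simp add: algebra_simps)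
        also have "\<bar>c\<bar> + 1 \<noteq> 0" by linarith
        hence "(\<bar>c\<bar> + 1) * t k = \<delta> * inverse (real (Suc k))" by (simp add: t_def)
        also have "\<dots> \<le> \<delta> * 1" using \<delta>(1) by (intro mult_left_mono) (auto simp: field_simps)
        finally show ?thesis by simp
      qed
      hence S: "shear_point s (y k) (\<phi> (y k)) \<in> S" for k using \<delta>(2) in_S by blast
      have "y \<longlonglongrightarrow> x0 + c * 0" unfolding y_def[abs_def] by (intro tendsto_intros t0)
      hence "(\<lambda>k. g (y k)) \<longlonglongrightarrow> d" using isCont_tendsto_compose[OF g(2)] g(3) by simp
      hence "(\<lambda>k. c *\<^sub>R shear_point s 1 (g (y k))) \<longlonglongrightarrow> v" unfolding v u_def by (intro tendsto_intros)
      moreover have "(shear_point s (y k) (\<phi> (y k)) - ?z) /\<^sub>R t k = c *\<^sub>R shear_point s 1 (g (y k))" for k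
        using t[of k] unfolding diff by (simp add: y_def)
      ultimately show "v \<in> tangent_cone S ?z"
        unfolding tangent_cone_def using t t0 S
        by (intro CollectI exI[of _ "\<lambda>k. shear_point s (y k) (\<phi> (y k))"] exI[of _ t]) simp
    qed
  qed
  ultimately show ?thesis unfolding has_tangent_def by blast
qed

section \<open>Plane sets with algebraic frontier\<close>

lemma smooth_regular_on_graph:
  fixes D :: "nat \<Rightarrow> real \<Rightarrow> real"
  assumes "D 0 = \<phi>" "\<And>k x. x \<in> U \<Longrightarrow> (D k has_field_derivative D (Suc k) x) (at x)"
  shows "smooth_regular_on U (\<lambda>x. shear_point s x (\<phi> x))"
proof -
  define E where "E k x = shear_point s (if k = 0 then x else if k = 1 then 1 else 0) (D k x)" for k x
  have "(E k has_vector_derivative E (Suc k) x) (at x)" if x: "x \<in> U" for k x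
  proof -
    have "((\<lambda>x. if k = 0 then x else if k = 1 then 1 else 0) has_vector_derivative
        (if Suc k = 0 then x else if Suc k = 1 then 1 else 0 :: real)) (at x)"
      by (auto intro!: derivative_eq_intros)
    from bounded_linear.has_vector_derivative[OF bounded_linear_of_real this]
    have 1: "((\<lambda>x. complex_of_real (if k = 0 then x else if k = 1 then 1 else 0)) has_vector_derivative
        complex_of_real (if Suc k = 0 then x else if Suc k = 1 then 1 else 0)) (at x)" .
    have "(D k has_vector_derivative D (Suc k) x) (at x)"
      using assms(2)[OF x] by (simp add: has_real_derivative_iff_has_vector_derivative)
    from bounded_linear.has_vector_derivative[OF bounded_linear_mult_left[of "Complex s 1"]
        bounded_linear.has_vector_derivative[OF bounded_linear_of_real this]]
    have 2: "((\<lambda>x. complex_of_real (D k x) * Complex s 1) has_vector_derivative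
        complex_of_real (D (Suc k) x) * Complex s 1) (at x)" .
    show ?thesis using has_vector_derivative_add[OF 1 2]
      unfolding E_def[abs_def] shear_point_def .
  qed
  moreover have "E 0 = (\<lambda>x. shear_point s x (\<phi> x))" using assms(1) by (simp add: E_def[abs_def])
  moreover have "E 1 x \<noteq> 0" for x
  proof
    assume "E 1 x = 0"
    hence "Re (E 1 x) = 0" "Im (E 1 x) = 0" by simp_all
    thus False by (simp add: E_def)
  qed
  ultimately show ?thesis unfolding smooth_regular_on_def by (intro exI[of _ E]) blast
qed

text \<open>The parameter of a point of the graph is its sheared abscissa. So the graph map is injective, and
  the image of a closed set of parameters is cut out by closed conditions.\<close>

lemma proper_map_graph:
  assumes "closed I" "continuous_on I \<phi>"
  shows "proper_map (top_of_set I) euclidean (\<lambda>x. shear_point s x (\<phi> x))"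
proof (rule closed_injective_imp_proper_map)
  show "inj_on (\<lambda>x. shear_point s x (\<phi> x)) (topspace (top_of_set I))"
    by (rule inj_on_inverseI[of _ "shear_coord s"]) simp
  show "closed_map (top_of_set I) euclidean (\<lambda>x. shear_point s x (\<phi> x))"
    unfolding closed_map_def
  proof (intro allI impI)
    fix C assume "closedin (top_of_set I) C"
    hence C: "closed C" "C \<subseteq> I" using assms(1) by (auto simp: closedin_closed_eq)
    let ?P = "{z. shear_coord s z \<in> C}"
    have P: "closed ?P"
      using continuous_closed_vimage[OF C(1), of "shear_coord s"]
        continuous_shear(2)[OF continuous_on_id, of UNIV s]
      by (simp add: vimage_def continuous_on_eq_continuous_at)
    have "continuous_on ?P (\<lambda>z. \<phi> (shear_coord s z))"
      by (rule continuous_on_compose2[OF assms(2) continuous_shear(2)[OF continuous_on_id]]) (use C in auto)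
    hence "continuous_on ?P (\<lambda>z. Im z - \<phi> (shear_coord s z))" by (intro continuous_intros)
    hence "closed {z \<in> ?P. Im z - \<phi> (shear_coord s z) = 0}"
      using P by (rule continuous_closed_preimage_constant)
    also have "{z \<in> ?P. Im z - \<phi> (shear_coord s z) = 0} = (\<lambda>x. shear_point s x (\<phi> x)) ` C"
    proof (intro set_eqI iffI)
      fix z assume z: "z \<in> {z \<in> ?P. Im z - \<phi> (shear_coord s z) = 0}"
      hence "z = shear_point s (shear_coord s z) (\<phi> (shear_coord s z))"
        using shear_point_simps(4)[of s z] by simp
      with z show "z \<in> (\<lambda>x. shear_point s x (\<phi> x)) ` C" by blast
    qed auto
    finally show "closedin euclidean ((\<lambda>x. shear_point s x (\<phi> x)) ` C)" by simp
  qed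
qed

text \<open>The pieces of the curve are those branches that lie in the frontier, closed up by their limits. They
  cover the frontier: their union is closed and misses at most finitely many frontier points, none of
  which can be isolated. Different branches are disjoint, except that they may share limits over \<open>B\<close>.\<close>

theorem algebraic_frontier_piecewise_smooth:
  fixes L :: "complex set" and f :: "real poly poly"
  assumes L: "closed L" "L \<subseteq> closure (interior L)"
    and f: "f \<noteq> 0" "\<And>z. z \<in> frontier L \<Longrightarrow> bieval f (Re z) (Im z) = 0"
  shows "\<exists>c. piecewise_smooth_curve c \<and> curve_image c = frontier L \<and>
      finite {z \<in> frontier L. \<not> has_tangent (frontier L) z} \<and> finite (self_intersections c)"
proof -
  obtain s and B :: "real set" and n :: "real set \<Rightarrow> nat"
    and \<phi> :: "real set \<Rightarrow> nat \<Rightarrow> real \<Rightarrow> real" where B: "finite B"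
    and fin: "\<And>b. finite {y. bieval f (b + s * y) y = 0}"
    and cont: "\<And>J i. J \<in> components (- B) \<Longrightarrow> i < n J \<Longrightarrow> continuous_on (closure J) (\<phi> J i)"
    and smooth: "\<And>J i. J \<in> components (- B) \<Longrightarrow> i < n J \<Longrightarrow> \<exists>D :: nat \<Rightarrow> real \<Rightarrow> real. D 0 = \<phi> J i \<and>
        (\<forall>k. \<forall>x\<in>J. (D k has_field_derivative D (Suc k) x) (at x))"
    and less: "\<And>J i j x. J \<in> components (- B) \<Longrightarrow> i < j \<Longrightarrow> j < n J \<Longrightarrow> x \<in> J \<Longrightarrow> \<phi> J i x < \<phi> J j x"
    and roots: "\<And>J x y. J \<in> components (- B) \<Longrightarrow> x \<in> J \<Longrightarrow>
        bieval f (x + s * y) y = 0 \<longleftrightarrow> (\<exists>i<n J. y = \<phi> J i x)"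
    by (rule root_branches[OF f(1)]) (rule that; assumption)
  note comp = component_Compl_finite[OF B]
  let ?F = "frontier L"
  define \<gamma> where "\<gamma> J i x = shear_point s x (\<phi> J i x)" for J i x
  \<comment> \<open>\<open>lo\<close> and \<open>hi\<close> are the neighbouring branches, or parallel graphs where there is none\<close>
  define lo where "lo J i x = (if i = 0 then \<phi> J i x - 1 else \<phi> J (i - 1) x)" for J i x
  define hi where "hi J i x = (if Suc i < n J then \<phi> J (Suc i) x else \<phi> J i x + 1)" for J i x
  have on_curve: "bieval f (shear_coord s z + s * Im z) (Im z) = 0" if "z \<in> ?F" for z
    using f(2)[OF that] by (simp add: shear_coord_def)
  have cont_J: "continuous_on J (\<phi> J i)" if "J \<in> components (- B)" "i < n J" for J i
    using continuous_on_subset[OF cont[OF that] closure_subset] .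
  have lo_less: "lo J i x < \<phi> J i x" if "J \<in> components (- B)" "i < n J" "x \<in> J" for J i x
    using less[OF that(1), of "i - 1" i x] that by (simp add: lo_def)
  have less_hi: "\<phi> J i x < hi J i x" if "J \<in> components (- B)" "i < n J" "x \<in> J" for J i x
    using less[OF that(1), of i "Suc i" x] that by (simp add: hi_def)
  have cont_lo: "continuous_on J (lo J i)" and cont_hi: "continuous_on J (hi J i)"
    if "J \<in> components (- B)" "i < n J" for J i
    using cont_J[OF that(1)] that(2) unfolding lo_def[abs_def] hi_def[abs_def]
    by (cases "i = 0"; cases "Suc i < n J"; auto intro!: continuous_intros)+
  have only: "Im z = \<phi> J i (shear_coord s z)"
    if J: "J \<in> components (- B)" "i < n J" and z: "z \<in> tube s J (lo J i) (hi J i)" "z \<in> ?F" for J i z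
  proof -
    let ?x = "shear_coord s z"
    have x: "?x \<in> J" using z(1) by (simp add: tube_def)
    obtain j where j: "j < n J" "Im z = \<phi> J j ?x"
      using on_curve[OF z(2)] roots[OF J(1) x] by blast
    have mono: "\<phi> J k ?x \<le> \<phi> J l ?x" if "k \<le> l" "l < n J" for k l
      using less[OF J(1), of k l ?x] that x by (cases "k = l") auto
    have "\<not> j < i"
    proof
      assume "j < i"
      hence "\<phi> J j ?x \<le> lo J i ?x" using mono[of j "i - 1"] J(2) by (simp add: lo_def)
      thus False using z(1) j(2) by (simp add: tube_def)
    qed
    moreover have "\<not> i < j"
    proof
      assume "i < j"
      hence "hi J i ?x \<le> \<phi> J j ?x" using mono[of "Suc i" j] j(1) by (simp add: hi_def)
      thus False using z(1) j(2) by (simp add: tube_def)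
    qed
    ultimately show ?thesis using j by (metis linorder_neqE_nat)
  qed
  have dichotomy: "(\<forall>x\<in>J. \<gamma> J i x \<in> ?F) \<or> (\<forall>x\<in>J. \<gamma> J i x \<notin> ?F)"
    if J: "J \<in> components (- B)" "i < n J" for J i
    unfolding \<gamma>_def
    by (rule graph_in_frontier_or_disjoint[OF L comp(1)[OF J(1)] in_components_connected[OF J(1)]
        cont_lo[OF J] cont_J[OF J] cont_hi[OF J] lo_less[OF J] less_hi[OF J] only[OF J]])
  define Idx where "Idx = {(J, i). J \<in> components (- B) \<and> i < n J \<and> (\<forall>x\<in>J. \<gamma> J i x \<in> ?F)}"
  have "finite Idx"
  proof (rule finite_subset)
    show "Idx \<subseteq> (SIGMA J:components (- B). {..<n J})" by (auto simp: Idx_def)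
    show "finite (SIGMA J:components (- B). {..<n J})"
      using finite_components_Compl_finite[OF B] by blast
  qed
  then obtain xs where xs: "set xs = Idx" "distinct xs" using finite_distinct_list by blast
  define c :: curve where "c = map (\<lambda>(J, i). (closure J, \<gamma> J i)) xs"
  \<comment> \<open>the points of the curve over \<open>B\<close>, the only candidates for singular points\<close>
  define E where "E = {z. shear_coord s z \<in> B \<and> bieval f (Re z) (Im z) = 0}"
  have "E \<subseteq> (\<Union>b\<in>B. (\<lambda>y. shear_point s b y) ` {y. bieval f (b + s * y) y = 0})"
  proof
    fix z assume z: "z \<in> E"
    hence "Im z \<in> {y. bieval f (shear_coord s z + s * y) y = 0}" by (simp add: E_def shear_coord_def)
    hence "z \<in> (\<lambda>y. shear_point s (shear_coord s z) y) ` {y. bieval f (shear_coord s z + s * y) y = 0}"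
      by (intro image_eqI[of z _ "Im z"]) simp_all
    with z show "z \<in> (\<Union>b\<in>B. (\<lambda>y. shear_point s b y) ` {y. bieval f (b + s * y) y = 0})"
      by (auto simp: E_def)
  qed
  hence "finite E" by (rule finite_subset) (use B fin in auto)
  have arc: "\<exists>J i. (J, i) \<in> Idx \<and> shear_coord s z \<in> J \<and> z = \<gamma> J i (shear_coord s z)"
    if z: "z \<in> ?F" "shear_coord s z \<notin> B" for z
  proof -
    let ?x = "shear_coord s z"
    obtain J where J: "J \<in> components (- B)" "?x \<in> J"
      using z(2) Union_components[of "- B"] by blast
    obtain i where i: "i < n J" "Im z = \<phi> J i ?x" using on_curve[OF z(1)] roots[OF J] by blast
    hence "z = \<gamma> J i ?x" using shear_point_simps(4)[of s z] by (simp add: \<gamma>_def)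
    moreover from this have "(J, i) \<in> Idx" using dichotomy[OF J(1) i(1)] J i z(1) unfolding Idx_def by auto
    ultimately show ?thesis using J by blast
  qed
  have cont_\<gamma>: "continuous_on (closure J) (\<gamma> J i)" if "(J, i) \<in> Idx" for J i
    using cont[of J i] that unfolding \<gamma>_def[abs_def] Idx_def by (auto intro!: continuous_intros)
  have proper: "proper_map (top_of_set (closure J)) euclidean (\<gamma> J i)" if "(J, i) \<in> Idx" for J i
    using proper_map_graph[OF closed_closure cont[of J i]] that unfolding \<gamma>_def[abs_def] Idx_def by simp
  have image: "curve_image c = (\<Union>(J, i)\<in>Idx. \<gamma> J i ` closure J)"
    unfolding curve_image_def c_def using xs by auto
  have "piecewise_smooth_curve c"
    unfolding piecewise_smooth_curve_def
  proof (intro ballI, clarify)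
    fix I g assume "(I, g) \<in> set c"
    then obtain J i where Ji: "(J, i) \<in> Idx" "I = closure J" "g = \<gamma> J i"
      unfolding c_def using xs(1) by auto
    hence J: "J \<in> components (- B)" "i < n J" by (auto simp: Idx_def)
    have int: "interior I = J"
      using convex_interior_closure[OF comp(2)[OF J(1)]] comp(1)[OF J(1)] Ji by (simp add: interior_open)
    obtain D :: "nat \<Rightarrow> real \<Rightarrow> real" where "D 0 = \<phi> J i" "\<forall>k. \<forall>x\<in>J. (D k has_field_derivative D (Suc k) x) (at x)"
      using smooth[OF J] by blast
    hence "smooth_regular_on (interior I - {}) g"
      using smooth_regular_on_graph[of D "\<phi> J i" J s] int Ji unfolding \<gamma>_def[abs_def] by simp
    moreover have "is_interval I"
      using comp(2)[OF J(1)] Ji by (simp add: is_interval_convex_1 convex_closure)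
    ultimately show "is_interval I \<and> interior I \<noteq> {} \<and> continuous_on I g \<and>
        proper_map (top_of_set I) euclidean g \<and> (\<exists>F. finite F \<and> smooth_regular_on (interior I - F) g)"
      using int comp(3)[OF J(1)] cont_\<gamma>[OF Ji(1)] proper[OF Ji(1)] Ji(2,3)
      by (intro conjI exI[of _ "{}"]) simp_all
  qed
  moreover have image_eq: "curve_image c = ?F"
  proof
    show "curve_image c \<subseteq> ?F"
    proof -
      have "\<gamma> J i ` closure J \<subseteq> ?F" if "(J, i) \<in> Idx" for J i
        by (rule image_closure_subset[OF cont_\<gamma>[OF that] frontier_closed]) (use that in \<open>auto simp: Idx_def\<close>)
      thus ?thesis unfolding image by blast
    qed
    have "closed (\<gamma> J i ` closure J)" if "(J, i) \<in> Idx" for J i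
      using proper_imp_closed_map[OF proper[OF that]] unfolding closed_map_def by force
    hence K: "closed (curve_image c)"
      unfolding image using \<open>finite Idx\<close> by (intro closed_UN) auto
    have off_E: "?F - E \<subseteq> curve_image c"
    proof
      fix z assume z: "z \<in> ?F - E"
      hence "shear_coord s z \<notin> B" using f(2) by (auto simp: E_def)
      then obtain J i where "(J, i) \<in> Idx" "shear_coord s z \<in> J" "z = \<gamma> J i (shear_coord s z)"
        using arc z by blast
      thus "z \<in> curve_image c" unfolding image using closure_subset[of J] by blast
    qed
    show "?F \<subseteq> curve_image c"
    proof
      fix z assume "z \<in> ?F"
      hence "z islimpt ?F" by (rule frontier_no_isolated_points[OF L])
      hence "z islimpt (E \<union> (?F - E))" by (rule islimpt_subset) blast
      hence "z islimpt (?F - E)" using islimpt_Un_finite[OF \<open>finite E\<close>] by blast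
      hence "z islimpt curve_image c" using off_E by (rule islimpt_subset)
      thus "z \<in> curve_image c" using K closed_limpt by blast
    qed
  qed
  moreover have "{z \<in> ?F. \<not> has_tangent ?F z} \<subseteq> E"
  proof
    fix z assume z: "z \<in> {z \<in> ?F. \<not> has_tangent ?F z}"
    show "z \<in> E"
    proof (rule ccontr)
      assume "z \<notin> E"
      hence "shear_coord s z \<notin> B" using f(2) z by (auto simp: E_def)
      then obtain J i where Ji: "(J, i) \<in> Idx" "shear_coord s z \<in> J" "z = \<gamma> J i (shear_coord s z)"
        using arc z by blast
      let ?x = "shear_coord s z"
      have J: "J \<in> components (- B)" "i < n J" "\<And>x. x \<in> J \<Longrightarrow> \<gamma> J i x \<in> ?F" using Ji by (auto simp: Idx_def)
      obtain D :: "nat \<Rightarrow> real \<Rightarrow> real" where D: "D 0 = \<phi> J i"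
        "\<forall>k. \<forall>x\<in>J. (D k has_field_derivative D (Suc k) x) (at x)" using smooth[OF J(1,2)] by blast
      have "(\<phi> J i has_field_derivative D 1 ?x) (at ?x)" using D Ji(2) by (metis One_nat_def)
      moreover have "\<gamma> J i ?x \<in> tube s J (lo J i) (hi J i)"
        using lo_less[OF J(1,2) Ji(2)] less_hi[OF J(1,2) Ji(2)] Ji(2) by (simp add: \<gamma>_def tube_def)
      ultimately have "has_tangent ?F (\<gamma> J i ?x)"
        unfolding \<gamma>_def
        by (intro graph_has_tangent[OF comp(1)[OF J(1)] Ji(2), where T = "tube s J (lo J i) (hi J i)"]
            open_tube[OF comp(1)[OF J(1)] cont_lo[OF J(1,2)] cont_hi[OF J(1,2)]])
          (use J(3) only[OF J(1,2)] in \<open>auto simp: \<gamma>_def\<close>)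
      thus False using z Ji(3) by simp
    qed
  qed
  hence "finite {z \<in> ?F. \<not> has_tangent ?F z}" using \<open>finite E\<close> finite_subset by blast
  moreover have "self_intersections c \<subseteq> E"
  proof
    fix z assume "z \<in> self_intersections c"
    then obtain p q u t where pq: "p < length xs" "q < length xs" "u \<in> fst (c ! p)" "t \<in> fst (c ! q)"
      "(p, u) \<noteq> (q, t)" "snd (c ! p) u = z" "snd (c ! q) t = z"
      unfolding self_intersections_def by (auto simp: c_def)
    obtain J i where Ji: "xs ! p = (J, i)" by fastforce
    obtain J' i' where Ji': "xs ! q = (J', i')" by fastforce
    have Idx: "(J, i) \<in> Idx" "(J', i') \<in> Idx" using Ji Ji' pq xs(1) nth_mem by metis+
    hence J: "J \<in> components (- B)" "i < n J" "J' \<in> components (- B)" "i' < n J'" by (auto simp: Idx_def)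
    have ut: "u \<in> closure J" "t \<in> closure J'" "\<gamma> J i u = z" "\<gamma> J' i' t = z"
      using pq Ji Ji' by (auto simp: c_def)
    have "shear_coord s (\<gamma> J i u) = u" "shear_coord s (\<gamma> J' i' t) = t" by (simp_all add: \<gamma>_def)
    hence u: "u = shear_coord s z" "t = shear_coord s z" using ut(3,4) by simp_all
    have zF: "z \<in> ?F" using ut(1,3) Idx(1) unfolding image_eq[symmetric] image by blast
    show "z \<in> E"
    proof (rule ccontr)
      assume "z \<notin> E"
      hence nB: "u \<notin> B" using f(2)[OF zF] u by (auto simp: E_def)
      hence uJ: "u \<in> J" "u \<in> J'" using ut(1,2) u comp(4)[OF J(1)] comp(4)[OF J(3)] by auto
      hence "J = J'" using components_nonoverlap[OF J(1,3)] by blast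
      moreover have "i = i'"
      proof (rule ccontr)
        assume "i \<noteq> i'"
        hence "\<phi> J i u \<noteq> \<phi> J i' u"
          using less[OF J(1), of i i' u] less[OF J(1), of i' i u] J uJ \<open>J = J'\<close>
          by (cases i i' rule: linorder_cases) auto
        moreover have "Im (\<gamma> J i u) = Im (\<gamma> J i' u)" using ut u \<open>J = J'\<close> by simp
        ultimately show False by (simp add: \<gamma>_def)
      qed
      ultimately have "p = q" using Ji Ji' pq(1,2) xs(2) nth_eq_iff_index_eq by metis
      thus False using pq(5) u by simp
    qed
  qed
  hence "finite (self_intersections c)" using \<open>finite E\<close> finite_subset by blast
  ultimately show ?thesis by blast
qed


section \<open>Singular values and the Gram matrix\<close>

definition conj_transpose :: "complex^'n^'n \<Rightarrow> complex^'n^'n" where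
  "conj_transpose A = (\<chi> i j. cnj (A $ j $ i))"

lemma inner_conj_transpose: "(A *v x) \<bullet> y = x \<bullet> (conj_transpose A *v y)"
proof -
  have inner_Re: "a \<bullet> b = Re (\<Sum>i\<in>UNIV. a $ i * cnj (b $ i))" for a b :: "complex^'n"
    by (simp add: inner_vec_def inner_complex_def)
  have "(\<Sum>i\<in>UNIV. (A *v x) $ i * cnj (y $ i)) = (\<Sum>i\<in>UNIV. \<Sum>j\<in>UNIV. A $ i $ j * x $ j * cnj (y $ i))"
    by (simp add: matrix_vector_mult_def sum_distrib_right)
  also have "\<dots> = (\<Sum>j\<in>UNIV. \<Sum>i\<in>UNIV. A $ i $ j * x $ j * cnj (y $ i))" by (rule sum.swap)
  also have "\<dots> = (\<Sum>j\<in>UNIV. x $ j * cnj ((conj_transpose A *v y) $ j))"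
    by (simp add: matrix_vector_mult_def conj_transpose_def sum_distrib_left mult_ac)
  finally show ?thesis unfolding inner_Re by simp
qed

text \<open>This matrix is singular exactly if \<open>\<bar>\<tau>\<bar>\<close> is a singular value of \<open>A\<close>. Unlike the smallest singular
  value itself, its determinant is a polynomial in the entries, their conjugates and \<open>\<tau>\<close>.\<close>

definition gram_shift :: "complex^'n^'n \<Rightarrow> real \<Rightarrow> complex^'n^'n" where
  "gram_shift A \<tau> = conj_transpose A ** A - mat (of_real (\<tau>\<^sup>2))"

lemma gram_shift_mult_vec:
  fixes A :: "complex^'n^'n"
  shows "gram_shift A \<tau> *v v = conj_transpose A *v (A *v v) - \<tau>\<^sup>2 *\<^sub>R v"
proof -
  have "(mat (of_real c) :: complex^'n^'n) *v v = c *\<^sub>R v" for c :: real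
    by (simp add: vec_eq_iff matrix_vector_mult_def mat_def if_distrib[of "\<lambda>x. x * _"] cong: if_cong)
      (simp add: scaleR_conv_of_real)
  thus ?thesis unfolding gram_shift_def
    by (simp add: matrix_vector_mult_diff_rdistrib matrix_vector_mul_assoc del: of_real_power)
qed

lemma gram_shift_kernel_norm:
  assumes "gram_shift A \<tau> *v v = 0" "\<tau> \<ge> 0"
  shows "norm (A *v v) = \<tau> * norm v"
proof -
  have "(norm (A *v v))\<^sup>2 = v \<bullet> (conj_transpose A *v (A *v v))"
    unfolding power2_norm_eq_inner by (rule inner_conj_transpose)
  also have "\<dots> = (\<tau> * norm v)\<^sup>2"
    using assms(1) unfolding gram_shift_mult_vec
    by (simp add: power_mult_distrib power2_norm_eq_inner)
  finally show ?thesis using assms(2) by (simp add: power2_eq_iff_nonneg)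
qed

text \<open>The quadratic form \<open>Q x = (norm (A *v x))\<^sup>2 - \<tau>\<^sup>2 * (norm x)\<^sup>2\<close> is nonnegative and vanishes at
  \<open>v\<close>, so its gradient vanishes at \<open>v\<close>; half that gradient is \<open>b = gram_shift A \<tau> *v v\<close>. Otherwise a short step
  from \<open>v\<close> along \<open>- b\<close> would make \<open>Q\<close> negative.\<close>

lemma minimiser_in_gram_shift_kernel:
  assumes min: "\<And>x. \<tau> * norm x \<le> norm (A *v x)" and v: "norm (A *v v) = \<tau> * norm v" and \<tau>: "\<tau> \<ge> 0"
  shows "gram_shift A \<tau> *v v = 0"
proof (rule ccontr)
  define b where "b = gram_shift A \<tau> *v v"
  assume "gram_shift A \<tau> *v v \<noteq> 0"
  hence b: "b \<bullet> b > 0" by (simp add: b_def)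
  define Q where "Q x = (A *v x) \<bullet> (A *v x) - \<tau>\<^sup>2 * (x \<bullet> x)" for x
  have Q_nonneg: "Q x \<ge> 0" for x
  proof -
    have "(\<tau> * norm x)\<^sup>2 \<le> (norm (A *v x))\<^sup>2" using min \<tau> by (intro power_mono) auto
    thus ?thesis by (simp add: Q_def power_mult_distrib power2_norm_eq_inner)
  qed
  have "(norm (A *v v))\<^sup>2 = (\<tau> * norm v)\<^sup>2" using v by simp
  hence Qv: "Q v = 0" by (simp add: Q_def power_mult_distrib power2_norm_eq_inner)
  have cross: "(A *v v) \<bullet> (A *v b) - \<tau>\<^sup>2 * (v \<bullet> b) = b \<bullet> b"
  proof -
    have "(A *v v) \<bullet> (A *v b) = b \<bullet> (conj_transpose A *v (A *v v))"
      by (subst inner_commute) (rule inner_conj_transpose)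
    moreover have "b \<bullet> b = b \<bullet> (conj_transpose A *v (A *v v)) - \<tau>\<^sup>2 * (b \<bullet> v)"
      by (subst (2) b_def) (simp add: gram_shift_mult_vec inner_diff_right)
    ultimately show ?thesis by (simp add: inner_commute)
  qed
  have expand: "Q (v + t *\<^sub>R b) = Q v + 2 * t * (b \<bullet> b) + t\<^sup>2 * Q b" for t
  proof -
    have "A *v (v + t *\<^sub>R b) = A *v v + t *\<^sub>R (A *v b)"
      using linear_add[OF matrix_vector_mul_linear, of A] linear_scale[OF matrix_vector_mul_linear, of A] by simp
    hence "Q (v + t *\<^sub>R b) = Q v + 2 * t * ((A *v v) \<bullet> (A *v b) - \<tau>\<^sup>2 * (v \<bullet> b)) + t\<^sup>2 * Q b"
      unfolding Q_def
      by (simp add: inner_add_left inner_add_right inner_commute power2_eq_square algebra_simps)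
    thus ?thesis unfolding cross .
  qed
  \<comment> \<open>the step length \<open>(b \<bullet> b) / (Q b + 1)\<close> works also if \<open>Q b = 0\<close>\<close>
  let ?q = "Q b + 1"
  have q: "?q > 0" using Q_nonneg[of b] by simp
  have square: "2 * (- \<beta> / q) * \<beta> + (- \<beta> / q)\<^sup>2 * c = \<beta>\<^sup>2 * (c - 2 * q) / q\<^sup>2" if "q \<noteq> 0" for \<beta> q c :: real
    using that by (simp add: field_simps power2_eq_square)
  have "Q (v + (- (b \<bullet> b) / ?q) *\<^sub>R b) = (b \<bullet> b)\<^sup>2 * (Q b - 2 * ?q) / ?q\<^sup>2"
    unfolding expand Qv using square[of ?q "b \<bullet> b" "Q b"] q by simp
  also have "\<dots> < 0"
    using b q Q_nonneg[of b] by (intro divide_neg_pos mult_pos_neg) auto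
  finally show False using Q_nonneg[of "v + (- (b \<bullet> b) / ?q) *\<^sub>R b"] by simp
qed

section \<open>Polynomials in the coordinates and the modulus\<close>

text \<open>Since the square of \<open>cmod z\<close> is a polynomial in \<open>Re z\<close> and \<open>Im z\<close>, these functions form a ring;
  it contains every real polynomial in \<open>Re z\<close>, \<open>Im z\<close> and \<open>cmod z\<close>.\<close>

definition radial_poly :: "(complex \<Rightarrow> real) \<Rightarrow> bool" where
  "radial_poly g \<longleftrightarrow> (\<exists>p q. \<forall>z. g z = bieval p (Re z) (Im z) + bieval q (Re z) (Im z) * cmod z)"

definition complex_radial_poly :: "(complex \<Rightarrow> complex) \<Rightarrow> bool" where
  "complex_radial_poly g \<longleftrightarrow> radial_poly (\<lambda>z. Re (g z)) \<and> radial_poly (\<lambda>z. Im (g z))"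

lemma radial_polyI: "(\<And>z. g z = bieval p (Re z) (Im z) + bieval q (Re z) (Im z) * cmod z) \<Longrightarrow> radial_poly g"
  unfolding radial_poly_def by blast

lemma radial_poly_basic:
  "radial_poly (\<lambda>z. c)" "radial_poly Re" "radial_poly Im" "radial_poly cmod"
proof -
  show "radial_poly (\<lambda>z. c)" by (rule radial_polyI[of _ "[:[:c:]:]" 0]) simp
  show "radial_poly Re" by (rule radial_polyI[of _ "[:[:0, 1:]:]" 0]) simp
  show "radial_poly Im" by (rule radial_polyI[of _ "[:0, 1:]" 0]) (simp add: bieval_pCons)
  show "radial_poly cmod" by (rule radial_polyI[of _ 0 1]) simp
qed

lemma radial_poly_add:
  assumes "radial_poly f" "radial_poly g"
  shows "radial_poly (\<lambda>z. f z + g z)"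
proof -
  obtain p q p' q' where *: "\<And>z. f z = bieval p (Re z) (Im z) + bieval q (Re z) (Im z) * cmod z"
    "\<And>z. g z = bieval p' (Re z) (Im z) + bieval q' (Re z) (Im z) * cmod z"
    using assms unfolding radial_poly_def by blast
  show ?thesis by (rule radial_polyI[of _ "p + p'" "q + q'"]) (simp add: * algebra_simps)
qed

lemma radial_poly_mult:
  assumes "radial_poly f" "radial_poly g"
  shows "radial_poly (\<lambda>z. f z * g z)"
proof -
  obtain p q p' q' where *: "\<And>z. f z = bieval p (Re z) (Im z) + bieval q (Re z) (Im z) * cmod z"
    "\<And>z. g z = bieval p' (Re z) (Im z) + bieval q' (Re z) (Im z) * cmod z"
    using assms unfolding radial_poly_def by blast
  define N :: "real poly poly" where "N = [:[:0, 0, 1:], 0, 1:]"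
  have "(cmod z)\<^sup>2 = bieval N (Re z) (Im z)" for z
    by (simp add: N_def bieval_pCons cmod_power2) (simp add: power2_eq_square)
  hence N: "cmod z * cmod z = bieval N (Re z) (Im z)" for z by (simp add: power2_eq_square)
  show ?thesis
    by (rule radial_polyI[of _ "p * p' + N * (q * q')" "p * q' + q * p'"])
      (simp add: * N[symmetric] algebra_simps)
qed

lemma radial_poly_uminus: "radial_poly f \<Longrightarrow> radial_poly (\<lambda>z. - f z)"
  using radial_poly_mult[OF radial_poly_basic(1)[of "-1"], of f] by simp

lemma complex_radial_poly_basic:
  "complex_radial_poly (\<lambda>z. c)" "complex_radial_poly (\<lambda>z. z)" "complex_radial_poly (\<lambda>z. of_real (cmod z))"
  unfolding complex_radial_poly_def by (simp_all add: radial_poly_basic)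

lemma complex_radial_poly_closed:
  assumes "complex_radial_poly f" "complex_radial_poly g"
  shows "complex_radial_poly (\<lambda>z. f z + g z)" "complex_radial_poly (\<lambda>z. f z * g z)"
    "complex_radial_poly (\<lambda>z. f z - g z)"
  using assms unfolding complex_radial_poly_def
  by (auto simp: diff_conv_add_uminus simp del: add_uminus_conv_diff
      intro!: radial_poly_add radial_poly_mult radial_poly_uminus)

lemma complex_radial_poly_cnj: "complex_radial_poly f \<Longrightarrow> complex_radial_poly (\<lambda>z. cnj (f z))"
  unfolding complex_radial_poly_def by (simp add: radial_poly_uminus)

lemma complex_radial_poly_power: "complex_radial_poly f \<Longrightarrow> complex_radial_poly (\<lambda>z. f z ^ k)"
  by (induction k) (auto intro: complex_radial_poly_basic complex_radial_poly_closed)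

lemma complex_radial_poly_sum_prod:
  assumes "\<And>i. i \<in> A \<Longrightarrow> complex_radial_poly (f i)"
  shows "complex_radial_poly (\<lambda>z. \<Sum>i\<in>A. f i z)" "complex_radial_poly (\<lambda>z. \<Prod>i\<in>A. f i z)"
  using assms by (induction A rule: infinite_finite_induct)
    (auto intro: complex_radial_poly_basic complex_radial_poly_closed)

lemmas complex_radial_poly_intros = complex_radial_poly_basic complex_radial_poly_closed
  complex_radial_poly_cnj complex_radial_poly_power complex_radial_poly_sum_prod

lemma complex_radial_poly_det:
  fixes M :: "complex \<Rightarrow> complex^'n^'n"
  assumes "\<And>i j. complex_radial_poly (\<lambda>z. M z $ i $ j)"
  shows "complex_radial_poly (\<lambda>z. det (M z))"
  unfolding det_def by (intro complex_radial_poly_intros assms)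

text \<open>Count the order of the root \<open>\<i> * c\<close>: it is even on the left and odd on the right, unless both sides
  vanish.\<close>

lemma no_square_root_of_quadratic:
  fixes a b :: "real poly"
  assumes "a * a = b * b * [:c\<^sup>2, 0, 1:]" "c \<noteq> 0"
  shows "b = 0"
proof (rule ccontr)
  assume "b \<noteq> 0"
  let ?h = "map_poly complex_of_real"
  have hom: "?h (p * q) = ?h p * ?h q" for p q
    by (rule poly_eqI) (simp add: coeff_map_poly coeff_mult)
  have nz: "?h p = 0 \<longleftrightarrow> p = 0" for p by (simp add: map_poly_eq_0_iff)
  let ?u = "[:- (\<i> * c), 1:]" and ?v = "[:\<i> * c, 1:]"
  have "?h [:c\<^sup>2, 0, 1:] = ?u * ?v"
    by (simp add: map_poly_pCons power2_eq_square mult_ac)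
  hence eq: "?h a * ?h a = ?h b * ?h b * (?u * ?v)"
    using arg_cong[OF assms(1), of ?h] by (simp only: hom)
  have "?h b \<noteq> 0" using \<open>b \<noteq> 0\<close> nz by blast
  hence r: "?h b * ?h b * (?u * ?v) \<noteq> 0" unfolding mult_eq_0_iff by simp
  hence l: "?h a * ?h a \<noteq> 0" using eq by simp
  have "order (\<i> * c) ?u = 1" using order_power_n_n[of "\<i> * c" 1] by simp
  moreover have "order (\<i> * c) ?v = 0"
    by (rule order_0I) (use assms(2) in simp)
  ultimately have "order (\<i> * c) (?h b * ?h b * (?u * ?v)) = 2 * order (\<i> * c) (?h b) + 1"
    using r \<open>?h b \<noteq> 0\<close> by (simp add: order_mult del: mult_pCons_left mult_pCons_right)
  moreover have "order (\<i> * c) (?h a * ?h a) = 2 * order (\<i> * c) (?h a)"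
    using l by (simp add: order_mult)
  ultimately have "2 * order (\<i> * c) (?h a) = 2 * order (\<i> * c) (?h b) + 1" using eq by simp
  thus False by presburger
qed

text \<open>If \<open>g = p + q * cmod z\<close>, then \<open>f = p\<^sup>2 - q\<^sup>2 * (x\<^sup>2 + y\<^sup>2)\<close> is \<open>g\<close> times its conjugate
  \<open>p - q * cmod z\<close>. The conjugate could vanish wherever \<open>g\<close> does not, so \<open>f \<noteq> 0\<close> needs an
  argument: if \<open>f = 0\<close>, then on each line \<open>x = c\<close> with \<open>c \<noteq> 0\<close> the polynomial \<open>y\<^sup>2 + c\<^sup>2\<close>, which has simple
  roots, would be a quotient of squares, unless \<open>p\<close> and \<open>q\<close> vanish on the line.\<close>

lemma radial_poly_zeros_on_algebraic_curve:
  assumes "radial_poly g" "g z0 \<noteq> 0"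
  shows "\<exists>f. f \<noteq> 0 \<and> (\<forall>z. g z = 0 \<longrightarrow> bieval f (Re z) (Im z) = 0)"
proof -
  obtain p q where g: "\<And>z. g z = bieval p (Re z) (Im z) + bieval q (Re z) (Im z) * cmod z"
    using assms(1) unfolding radial_poly_def by blast
  define N :: "real poly poly" where "N = [:[:0, 0, 1:], 0, 1:]"
  have N: "bieval N (Re z) (Im z) = (cmod z)\<^sup>2" for z
    by (simp add: N_def bieval_pCons cmod_power2) (simp add: power2_eq_square)
  define f where "f = p * p - q * q * N"
  have f: "bieval f (Re z) (Im z) = g z * (bieval p (Re z) (Im z) - bieval q (Re z) (Im z) * cmod z)" for z
    by (simp add: f_def g N power2_eq_square algebra_simps)
  have "f \<noteq> 0"
  proof
    assume "f = 0"
    have zero: "g z = 0" if "Re z \<noteq> 0" for z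
    proof -
      have "slice (Re z) N = [:(Re z)\<^sup>2, 0, 1:]"
        by (simp add: N_def slice_pCons power2_eq_square) (simp add: slice_def)
      moreover have "p * p = q * q * N" using \<open>f = 0\<close> by (simp add: f_def)
      from arg_cong[OF this, of "slice (Re z)"]
      have sq: "slice (Re z) p * slice (Re z) p = slice (Re z) q * slice (Re z) q * slice (Re z) N"
        by (simp only: slice_hom)
      ultimately have "slice (Re z) q = 0" using no_square_root_of_quadratic[OF _ that] by metis
      moreover from this sq have "slice (Re z) p = 0" by simp
      ultimately show ?thesis unfolding g by (metis poly_0 poly_slice mult_zero_left add_0)
    qed
    have "continuous_on UNIV g" unfolding g by (intro continuous_intros)
    hence "open {z. g z \<noteq> 0}" by (intro open_Collect_neq continuous_on_const)
    then obtain r where r: "r > 0" "ball z0 r \<subseteq> {z. g z \<noteq> 0}"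
      using assms(2) unfolding open_contains_ball by blast
    \<comment> \<open>moving off the axis \<open>Re z = 0\<close>, on which \<open>y\<^sup>2 + c\<^sup>2\<close> is a square\<close>
    define z1 where "z1 = (if Re z0 = 0 then z0 + of_real (r / 2) else z0)"
    have "Re z1 \<noteq> 0" "z1 \<in> ball z0 r" using r(1) by (auto simp: z1_def dist_norm)
    thus False using zero r(2) by blast
  qed
  moreover have "\<forall>z. g z = 0 \<longrightarrow> bieval f (Re z) (Im z) = 0" by (simp add: f)
  ultimately show ?thesis by blast
qed


section \<open>Matrix polynomials and their pseudospectra\<close>

lemma det_eq_0_iff_kernel:
  fixes A :: "complex^'n^'n"
  shows "det A = 0 \<longleftrightarrow> (\<exists>v. v \<noteq> 0 \<and> A *v v = 0)"
  using matrix_left_invertible_ker[of A] invertible_det_nz[of A] invertible_left_inverse[of A] by blast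

lemma norm_matrix_vector_le: "norm (A *v v) \<le> spectral_norm A * norm v" for A :: "complex^'n^'n"
  unfolding spectral_norm_def by (rule onorm) simp

lemma spectral_norm_le: "(\<And>v. norm (A *v v) \<le> b * norm v) \<Longrightarrow> spectral_norm A \<le> b" for A :: "complex^'n^'n"
  unfolding spectral_norm_def by (rule onorm_le)

lemma matpoly_eval_nth:
  fixes P :: "nat \<Rightarrow> complex^'n^'n"
  shows "matpoly_eval m P z $ i $ k = (\<Sum>j\<le>m. z ^ j * P j $ i $ k)"
proof -
  have "(mat c ** A) $ i $ k = c * A $ i $ k" for c i k and A :: "complex^'n^'n"
    by (simp add: mat_def matrix_matrix_mult_def if_distrib[of "\<lambda>x. x * _"] sum.delta' cong: if_cong)
  thus ?thesis by (simp add: matpoly_eval_def sum_component)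
qed

lemma matpoly_eval_mult_vec:
  "matpoly_eval m P z *v v = (\<Sum>j\<le>m. z ^ j *s (P j *v v))"
proof (rule vec_eq_iff[THEN iffD2], rule allI)
  fix i
  have "(matpoly_eval m P z *v v) $ i = (\<Sum>k\<in>UNIV. \<Sum>j\<le>m. z ^ j * (P j $ i $ k * v $ k))"
    by (simp add: matrix_vector_mult_def matpoly_eval_nth sum_distrib_right mult.assoc)
  also have "\<dots> = (\<Sum>j\<le>m. \<Sum>k\<in>UNIV. z ^ j * (P j $ i $ k * v $ k))" by (rule sum.swap)
  finally show "(matpoly_eval m P z *v v) $ i = (\<Sum>j\<le>m. z ^ j *s (P j *v v)) $ i"
    by (simp add: matrix_vector_mult_def sum_distrib_left)
qed

lemma matpoly_eval_add:
  fixes P :: "nat \<Rightarrow> complex^'n^'n"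
  shows "matpoly_eval m (\<lambda>j. P j + \<Delta> j) z = matpoly_eval m P z + matpoly_eval m \<Delta> z"
  by (simp add: vec_eq_iff matpoly_eval_nth ring_distribs sum.distrib)

lemma norm_vec_sq: "(norm v)\<^sup>2 = (\<Sum>k\<in>UNIV. (cmod (v $ k))\<^sup>2)" for v :: "complex^'n"
  unfolding norm_vec_def L2_set_def by (simp add: sum_nonneg)

lemma norm_smult_vec: "norm (c *s v) = cmod c * norm v" for v :: "complex^'n"
  unfolding norm_vec_def by (simp add: norm_mult L2_set_left_distrib[symmetric] L2_set_def power_mult_distrib
     sum_distrib_left[symmetric] real_sqrt_mult)

definition weight :: "nat \<Rightarrow> (nat \<Rightarrow> real) \<Rightarrow> real \<Rightarrow> real" where
  "weight m w x = (\<Sum>j\<le>m. w j * x ^ j)"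

lemma weight_pos:
  assumes "w 0 > 0" "\<forall>j\<in>{1..m}. w j \<ge> 0" "x \<ge> 0"
  shows "weight m w x > 0"
proof -
  have "w 0 * x ^ 0 \<le> weight m w x"
    unfolding weight_def
  proof (rule member_le_sum)
    fix j assume "j \<in> {..m} - {0}"
    hence "w j \<ge> 0" using assms(2) by auto
    thus "0 \<le> w j * x ^ j" using assms(3) by simp
  qed auto
  thus ?thesis using assms(1) by simp
qed

lemma norm_perturbation_le:
  assumes "\<forall>j\<le>m. spectral_norm (\<Delta> j) \<le> \<epsilon> * w j"
  shows "norm (matpoly_eval m \<Delta> z *v v) \<le> \<epsilon> * weight m w (cmod z) * norm v"
proof -
  have "norm (matpoly_eval m \<Delta> z *v v) \<le> (\<Sum>j\<le>m. norm (z ^ j *s (\<Delta> j *v v)))"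
    unfolding matpoly_eval_mult_vec by (rule norm_sum)
  also have "\<dots> \<le> (\<Sum>j\<le>m. cmod z ^ j * (\<epsilon> * w j * norm v))"
  proof (rule sum_mono)
    fix j assume "j \<in> {..m}"
    hence "norm (\<Delta> j *v v) \<le> \<epsilon> * w j * norm v"
      using norm_matrix_vector_le[of "\<Delta> j" v] assms
      by (meson atMost_iff mult_right_mono norm_ge_zero order_trans)
    thus "norm (z ^ j *s (\<Delta> j *v v)) \<le> cmod z ^ j * (\<epsilon> * w j * norm v)"
      unfolding norm_smult_vec norm_power by (intro mult_left_mono) auto
  qed
  also have "\<dots> = \<epsilon> * weight m w (cmod z) * norm v"
    unfolding weight_def by (simp add: sum_distrib_left sum_distrib_right mult_ac)
  finally show ?thesis .
qed

lemma cnj_mult_sum_le: "cmod (\<Sum>k\<in>UNIV. cnj (v $ k) * x $ k) \<le> norm v * norm x" for v x :: "complex^'n"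
proof -
  have "cmod (\<Sum>k\<in>UNIV. cnj (v $ k) * x $ k) \<le> (\<Sum>k\<in>UNIV. \<bar>norm (v $ k)\<bar> * \<bar>norm (x $ k)\<bar>)"
    by (rule order.trans[OF norm_sum]) (simp add: norm_mult)
  also have "\<dots> \<le> norm v * norm x" unfolding norm_vec_def by (rule L2_set_mult_ineq)
  finally show ?thesis .
qed

text \<open>The characterisation through the smallest singular value, with the singular value expressed
  by a vector. Given a vector \<open>v\<close> with small image \<open>y\<close>, the rank-one matrix that maps \<open>v\<close> to \<open>- y\<close> and
  vanishes on its orthogonal complement is distributed over the coefficients in proportion to their
  weights. The factors \<open>cnj (sgn \<mu>) ^ j\<close> undo the phases of \<open>\<mu> ^ j\<close>, so that the pieces add up
  without cancellation.\<close>

lemma pseudospectrum_iff: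
  fixes P :: "nat \<Rightarrow> complex^'n^'n"
  assumes w: "w 0 > 0" "\<forall>j\<in>{1..m}. w j \<ge> 0" and \<epsilon>: "\<epsilon> > 0"
  shows "\<mu> \<in> pseudospectrum m P \<epsilon> w \<longleftrightarrow>
    (\<exists>v. v \<noteq> 0 \<and> norm (matpoly_eval m P \<mu> *v v) \<le> \<epsilon> * weight m w (cmod \<mu>) * norm v)"
proof
  assume "\<mu> \<in> pseudospectrum m P \<epsilon> w"
  then obtain \<Delta> where \<Delta>: "\<forall>j\<le>m. spectral_norm (\<Delta> j) \<le> \<epsilon> * w j"
    "det (matpoly_eval m (\<lambda>j. P j + \<Delta> j) \<mu>) = 0"
    by (auto simp: pseudospectrum_def perturbations_def)
  then obtain v where v: "v \<noteq> 0" "matpoly_eval m (\<lambda>j. P j + \<Delta> j) \<mu> *v v = 0"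
    by (auto simp: det_eq_0_iff_kernel)
  hence "matpoly_eval m P \<mu> *v v = - (matpoly_eval m \<Delta> \<mu> *v v)"
    by (simp add: matpoly_eval_add matrix_vector_mult_add_rdistrib eq_neg_iff_add_eq_0)
  with norm_perturbation_le[OF \<Delta>(1), of \<mu> v] v(1)
  show "\<exists>v. v \<noteq> 0 \<and> norm (matpoly_eval m P \<mu> *v v) \<le> \<epsilon> * weight m w (cmod \<mu>) * norm v"
    by (intro exI[of _ v]) simp
next
  assume "\<exists>v. v \<noteq> 0 \<and> norm (matpoly_eval m P \<mu> *v v) \<le> \<epsilon> * weight m w (cmod \<mu>) * norm v"
  then obtain v where v: "v \<noteq> 0" "norm (matpoly_eval m P \<mu> *v v) \<le> \<epsilon> * weight m w (cmod \<mu>) * norm v"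
    by blast
  let ?W = "weight m w (cmod \<mu>)" and ?y = "matpoly_eval m P \<mu> *v v"
  have W: "?W > 0" using weight_pos[OF w] by simp
  have nv: "norm v > 0" using v by simp
  define a where "a j = cnj (sgn \<mu>) ^ j * of_real (w j / ?W / (norm v)\<^sup>2)" for j
  define \<Delta> :: "nat \<Rightarrow> complex^'n^'n" where "\<Delta> j = (\<chi> i k. - (a j * cnj (v $ k) * ?y $ i))" for j
  have \<Delta>: "\<Delta> j *v x = (- a j * (\<Sum>k\<in>UNIV. cnj (v $ k) * x $ k)) *s ?y" for j x
    by (simp add: vec_eq_iff \<Delta>_def matrix_vector_mult_def sum_distrib_left sum_distrib_right
        sum_negf[symmetric] mult_ac)
  have "spectral_norm (\<Delta> j) \<le> \<epsilon> * w j" if j: "j \<le> m" for j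
  proof (rule spectral_norm_le)
    fix x
    have wj: "w j \<ge> 0" using w j by (cases "j = 0") (auto simp: less_imp_le)
    have "cmod (cnj (sgn \<mu>) ^ j) \<le> 1"
      by (simp add: norm_power norm_sgn power_le_one_iff)
    hence a: "cmod (a j) \<le> 1 * (w j / ?W / (norm v)\<^sup>2)"
      unfolding a_def norm_mult norm_of_real by (intro mult_mono) (use wj W in auto)
    have "norm (\<Delta> j *v x) = cmod (a j) * cmod (\<Sum>k\<in>UNIV. cnj (v $ k) * x $ k) * norm ?y"
      unfolding \<Delta> norm_smult_vec by (simp add: norm_mult)
    also have "\<dots> \<le> (1 * (w j / ?W / (norm v)\<^sup>2)) * (norm v * norm x) * (\<epsilon> * ?W * norm v)"
      by (intro mult_mono a cnj_mult_sum_le v(2)) (use wj W in auto)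
    also have "\<dots> = \<epsilon> * w j * norm x" using W nv by (simp add: power2_eq_square)
    finally show "norm (\<Delta> j *v x) \<le> \<epsilon> * w j * norm x" .
  qed
  moreover have "matpoly_eval m \<Delta> \<mu> *v v = - ?y"
  proof -
    have vv: "(\<Sum>k\<in>UNIV. cnj (v $ k) * v $ k) = of_real ((norm v)\<^sup>2)"
      by (simp only: norm_vec_sq of_real_sum complex_norm_square mult.commute)
    have pow: "\<mu> ^ j * cnj (sgn \<mu>) ^ j = of_real (cmod \<mu> ^ j)" for j
    proof -
      have "\<mu> * cnj (sgn \<mu>) = of_real (cmod \<mu>)"
        by (cases "\<mu> = 0") (simp_all add: sgn_eq complex_norm_square[symmetric] power2_eq_square)
      thus ?thesis by (metis of_real_power power_mult_distrib)
    qed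
    have "\<mu> ^ j * (a j * of_real ((norm v)\<^sup>2)) = of_real (w j * cmod \<mu> ^ j / ?W)" for j
    proof -
      have "\<mu> ^ j * (a j * of_real ((norm v)\<^sup>2)) =
          (\<mu> ^ j * cnj (sgn \<mu>) ^ j) * of_real (w j / ?W / (norm v)\<^sup>2 * (norm v)\<^sup>2)"
        unfolding a_def by (simp only: of_real_mult mult_ac)
      also have "w j / ?W / (norm v)\<^sup>2 * (norm v)\<^sup>2 = w j / ?W" using nv by simp
      finally show ?thesis unfolding pow of_real_mult[symmetric] by (simp add: mult_ac)
    qed
    hence "(\<Sum>j\<le>m. \<mu> ^ j * (a j * of_real ((norm v)\<^sup>2))) = of_real (\<Sum>j\<le>m. w j * cmod \<mu> ^ j / ?W)"
      by simp
    also have "(\<Sum>j\<le>m. w j * cmod \<mu> ^ j / ?W) = 1"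
      using W unfolding sum_divide_distrib[symmetric] by (simp add: weight_def)
    finally have one: "(\<Sum>j\<le>m. \<mu> ^ j * (a j * of_real ((norm v)\<^sup>2))) = 1" by simp
    have "(\<Sum>j\<le>m. \<mu> ^ j *s ((- a j * of_real ((norm v)\<^sup>2)) *s y))
        = - ((\<Sum>j\<le>m. \<mu> ^ j * (a j * of_real ((norm v)\<^sup>2))) *s y)" for y :: "complex^'n"
      by (simp add: vec_eq_iff sum_component sum_distrib_left sum_negf mult_ac)
    hence "matpoly_eval m \<Delta> \<mu> *v v = - ((\<Sum>j\<le>m. \<mu> ^ j * (a j * of_real ((norm v)\<^sup>2))) *s ?y)"
      unfolding matpoly_eval_mult_vec[of m \<Delta>] \<Delta> vv .
    thus ?thesis unfolding one by simp
  qed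
  hence "matpoly_eval m (\<lambda>j. P j + \<Delta> j) \<mu> *v v = 0"
    by (simp add: matpoly_eval_add matrix_vector_mult_add_rdistrib)
  hence "det (matpoly_eval m (\<lambda>j. P j + \<Delta> j) \<mu>) = 0"
    using v(1) det_eq_0_iff_kernel by blast
  ultimately show "\<mu> \<in> pseudospectrum m P \<epsilon> w"
    unfolding pseudospectrum_def perturbations_def by blast
qed

lemma continuous_on_matpoly_mult_vec:
  fixes P :: "nat \<Rightarrow> complex^'n^'n"
  assumes "continuous_on S f" "continuous_on S g"
  shows "continuous_on S (\<lambda>x. matpoly_eval m P (f x) *v g x)"
proof -
  have eq: "matpoly_eval m P z *v v = (\<chi> i. \<Sum>k\<in>UNIV. (\<Sum>j\<le>m. z ^ j * P j $ i $ k) * v $ k)" for z v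
    by (simp add: vec_eq_iff matrix_vector_mult_def matpoly_eval_nth)
  show ?thesis unfolding eq by (intro continuous_intros assms)
qed

lemma continuous_on_weight [continuous_intros]:
  "continuous_on S f \<Longrightarrow> continuous_on S (\<lambda>x. weight m w (f x))"
  unfolding weight_def by (intro continuous_intros)

text \<open>The vector in the characterisation may be taken from the unit sphere, which is compact.\<close>

lemma closed_pseudospectrum:
  fixes P :: "nat \<Rightarrow> complex^'n^'n"
  assumes w: "w 0 > 0" "\<forall>j\<in>{1..m}. w j \<ge> 0" and \<epsilon>: "\<epsilon> > 0"
  shows "closed (pseudospectrum m P \<epsilon> w)"
proof -
  let ?T = "{p :: (complex^'n) \<times> complex. norm (matpoly_eval m P (snd p) *v fst p)
      \<le> \<epsilon> * weight m w (cmod (snd p)) * norm (fst p)}"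
  have "closed ?T"
    by (intro closed_Collect_le continuous_intros continuous_on_matpoly_mult_vec)
  hence "closed {\<mu>. \<exists>v. v \<in> sphere 0 1 \<and> (v, \<mu>) \<in> ?T}"
    by (rule closed_compact_projection[OF compact_sphere])
  also have "{\<mu>. \<exists>v. v \<in> sphere 0 1 \<and> (v, \<mu>) \<in> ?T} = pseudospectrum m P \<epsilon> w"
  proof (intro set_eqI iffI)
    fix \<mu> assume "\<mu> \<in> {\<mu>. \<exists>v. v \<in> sphere 0 1 \<and> (v, \<mu>) \<in> ?T}"
    then obtain v where "norm v = 1" "(v, \<mu>) \<in> ?T" by auto
    thus "\<mu> \<in> pseudospectrum m P \<epsilon> w" unfolding pseudospectrum_iff[OF assms]
      by (intro exI[of _ v]) auto
  next
    fix \<mu> assume "\<mu> \<in> pseudospectrum m P \<epsilon> w"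
    then obtain v where v: "v \<noteq> 0"
      "norm (matpoly_eval m P \<mu> *v v) \<le> \<epsilon> * weight m w (cmod \<mu>) * norm v"
      unfolding pseudospectrum_iff[OF assms] by blast
    let ?u = "v /\<^sub>R norm v"
    have "matpoly_eval m P \<mu> *v ?u = (matpoly_eval m P \<mu> *v v) /\<^sub>R norm v"
      by (rule linear_scale[OF bounded_linear.linear]) simp
    hence "norm (matpoly_eval m P \<mu> *v ?u) = norm (matpoly_eval m P \<mu> *v v) / norm v"
      by (simp add: divide_inverse)
    also have "\<dots> \<le> \<epsilon> * weight m w (cmod \<mu>)" using v by (simp add: pos_divide_le_eq)
    finally have "norm (matpoly_eval m P \<mu> *v ?u) \<le> \<epsilon> * weight m w (cmod \<mu>)" .
    moreover have "norm ?u = 1" using v by simp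
    ultimately have "(?u, \<mu>) \<in> ?T" by (simp only: mem_Collect_eq fst_conv snd_conv mult_1_right)
    moreover have "?u \<in> sphere 0 1" using \<open>norm ?u = 1\<close> by (simp only: mem_sphere_0)
    ultimately show "\<mu> \<in> {\<mu>. \<exists>v. v \<in> sphere 0 1 \<and> (v, \<mu>) \<in> ?T}" by blast
  qed
  finally show ?thesis .
qed

text \<open>For a fixed vector the strict inequality persists near \<open>\<mu>\<close>.\<close>

lemma interior_pseudospectrumI:
  fixes P :: "nat \<Rightarrow> complex^'n^'n"
  assumes w: "w 0 > 0" "\<forall>j\<in>{1..m}. w j \<ge> 0" and \<epsilon>: "\<epsilon> > 0"
    and v: "norm (matpoly_eval m P \<mu> *v v) < \<epsilon> * weight m w (cmod \<mu>) * norm v"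
  shows "\<mu> \<in> interior (pseudospectrum m P \<epsilon> w)"
proof (rule interiorI)
  let ?U = "{z. norm (matpoly_eval m P z *v v) < \<epsilon> * weight m w (cmod z) * norm v}"
  show "open ?U"
    by (intro open_Collect_less continuous_intros continuous_on_matpoly_mult_vec)
  show "\<mu> \<in> ?U" using v by simp
  have "v \<noteq> 0" using v by auto
  thus "?U \<subseteq> pseudospectrum m P \<epsilon> w"
    by (auto simp: pseudospectrum_iff[OF w \<epsilon>] intro!: exI[of _ v])
qed

lemma uniform_limit_jointly_continuous:
  fixes F :: "real \<Rightarrow> complex \<Rightarrow> complex"
  assumes cont: "continuous_on UNIV (\<lambda>p. F (fst p) (snd p))"
    and t: "t \<longlonglongrightarrow> a" "\<And>n. t n \<in> {b..d}" "a \<in> {b..d}" and K: "compact K"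
  shows "uniform_limit K (\<lambda>n. F (t n)) (F a) sequentially"
proof (rule uniform_limitI)
  fix e :: real assume "e > 0"
  have "uniformly_continuous_on ({b..d} \<times> K) (\<lambda>p. F (fst p) (snd p))"
    by (intro compact_uniformly_continuous compact_Times K continuous_on_subset[OF cont]) auto
  then obtain \<delta> where \<delta>: "\<delta> > 0" "\<And>p q. p \<in> {b..d} \<times> K \<Longrightarrow> q \<in> {b..d} \<times> K \<Longrightarrow> dist q p < \<delta> \<Longrightarrow>
      dist (F (fst q) (snd q)) (F (fst p) (snd p)) < e"
    using \<open>e > 0\<close> unfolding uniformly_continuous_on_def by metis
  have "\<forall>\<^sub>F n in sequentially. dist (t n) a < \<delta>" by (rule tendstoD[OF t(1) \<delta>(1)])
  thus "\<forall>\<^sub>F n in sequentially. \<forall>x\<in>K. dist (F (t n) x) (F a x) < e"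
  proof eventually_elim
    case (elim n)
    show ?case using \<delta>(2)[of "(a, _)" "(t n, _)"] elim t by (auto simp: dist_Pair_Pair)
  qed
qed

text \<open>Let \<open>\<Delta>\<close> be admissible and \<open>F t z = det (P(z) + t \<Delta>(z))\<close> with \<open>F 1 \<mu> = 0\<close>. A zero of \<open>F t\<close>
  with \<open>t < 1\<close> is an interior point of the pseudospectrum, by the strict inequality. If there were none in a disc
  around \<open>\<mu>\<close>, Hurwitz' theorem for \<open>t \<longlonglongrightarrow> 1\<close> would force \<open>F 1\<close> to be constant on the disc, hence zero; but then
  the whole disc belongs to the pseudospectrum.\<close>

lemma pseudospectrum_subset_closure_interior:
  fixes P :: "nat \<Rightarrow> complex^'n^'n"
  assumes w: "w 0 > 0" "\<forall>j\<in>{1..m}. w j \<ge> 0" and \<epsilon>: "\<epsilon> > 0"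
  shows "pseudospectrum m P \<epsilon> w \<subseteq> closure (interior (pseudospectrum m P \<epsilon> w))"
proof (rule subsetI, rule ccontr)
  let ?L = "pseudospectrum m P \<epsilon> w"
  fix \<mu> assume \<mu>: "\<mu> \<in> ?L" "\<mu> \<notin> closure (interior ?L)"
  obtain \<Delta> where \<Delta>: "\<forall>j\<le>m. spectral_norm (\<Delta> j) \<le> \<epsilon> * w j"
    "det (matpoly_eval m (\<lambda>j. P j + \<Delta> j) \<mu>) = 0"
    using \<mu>(1) by (auto simp: pseudospectrum_def perturbations_def)
  have "open (- closure (interior ?L))" by (rule open_Compl[OF closed_closure])
  then obtain r where r: "r > 0" "ball \<mu> r \<subseteq> - closure (interior ?L)"
    using \<mu>(2) by (meson ComplI open_contains_ball)
  define F where "F t z = det (matpoly_eval m (\<lambda>j. P j + t *\<^sub>R \<Delta> j) z)" for t z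
  have F_eq: "F t z = (\<Sum>p | p permutes UNIV. of_int (sign p) *
      (\<Prod>i\<in>UNIV. \<Sum>j\<le>m. z ^ j * (P j $ i $ p i + of_real t * \<Delta> j $ i $ p i)))" for t z
    unfolding F_def det_def by (simp add: matpoly_eval_nth) (simp add: scaleR_conv_of_real)
  have nz: "F t z \<noteq> 0" if z: "z \<in> ball \<mu> r" and t: "0 \<le> t" "t < 1" for t z
  proof
    assume "F t z = 0"
    then obtain v where v: "v \<noteq> 0" "matpoly_eval m (\<lambda>j. P j + t *\<^sub>R \<Delta> j) z *v v = 0"
      unfolding F_def det_eq_0_iff_kernel by blast
    have "matpoly_eval m (\<lambda>j. t *\<^sub>R \<Delta> j) z = t *\<^sub>R matpoly_eval m \<Delta> z"
      by (simp add: vec_eq_iff matpoly_eval_nth scaleR_sum_right)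
    moreover have "(t *\<^sub>R M) *v v = t *\<^sub>R (M *v v)" for M :: "complex^'n^'n"
      by (simp add: vec_eq_iff matrix_vector_mult_def scaleR_sum_right)
    ultimately have "matpoly_eval m P z *v v = - (t *\<^sub>R (matpoly_eval m \<Delta> z *v v))"
      using v by (simp add: matpoly_eval_add matrix_vector_mult_add_rdistrib eq_neg_iff_add_eq_0)
    hence "norm (matpoly_eval m P z *v v) = t * norm (matpoly_eval m \<Delta> z *v v)" using t by simp
    also have "\<dots> \<le> t * (\<epsilon> * weight m w (cmod z) * norm v)"
      by (intro mult_left_mono norm_perturbation_le[OF \<Delta>(1)] t)
    also have "\<dots> < 1 * (\<epsilon> * weight m w (cmod z) * norm v)"
      using weight_pos[OF w, of "cmod z"] v(1) \<epsilon> t by (intro mult_strict_right_mono) auto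
    finally have "z \<in> interior ?L" using interior_pseudospectrumI[OF w \<epsilon>] by simp
    thus False using r(2) z closure_subset by blast
  qed
  define t where "t n = 1 - inverse (real (Suc n))" for n
  have t: "0 \<le> t n" "t n < 1" for n by (auto simp: t_def field_simps)
  have "t \<longlonglongrightarrow> 1 - 0" unfolding t_def[abs_def] by (intro tendsto_intros LIMSEQ_inverse_real_of_nat)
  hence t_lim: "t \<longlonglongrightarrow> 1" by simp
  have hol: "F a holomorphic_on S" for a S
    unfolding F_eq[abs_def] by (intro holomorphic_intros)
  have contF: "continuous_on UNIV (\<lambda>p. F (fst p) (snd p))"
    unfolding F_eq by (intro continuous_intros)
  have F1: "F 1 \<mu> = 0" using \<Delta>(2) by (simp add: F_def)
  have "F 1 constant_on ball \<mu> r"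
  proof (rule ccontr)
    assume nc: "\<not> F 1 constant_on ball \<mu> r"
    have "F 1 \<mu> \<noteq> 0"
    proof (rule Hurwitz_no_zeros[of "ball \<mu> r" "\<lambda>n. F (t n)" "F 1" \<mu>])
      show "uniform_limit K (\<lambda>n. F (t n)) (F 1) sequentially" if "compact K" for K
        using uniform_limit_jointly_continuous[OF contF t_lim, of 0 1 K] that t by (auto simp: less_imp_le)
    qed (use hol nz t r(1) nc in auto)
    with F1 show False by simp
  qed
  hence zero: "F 1 z = 0" if "z \<in> ball \<mu> r" for z
    using that F1 r(1) unfolding constant_on_def by (metis centre_in_ball)
  have "ball \<mu> r \<subseteq> ?L"
  proof
    fix z assume "z \<in> ball \<mu> r"
    hence "det (matpoly_eval m (\<lambda>j. P j + \<Delta> j) z) = 0" using zero by (simp add: F_def)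
    thus "z \<in> ?L" using \<Delta>(1) unfolding pseudospectrum_def perturbations_def by blast
  qed
  hence "\<mu> \<in> interior ?L" using r(1) interior_maximal[of "ball \<mu> r" ?L] by auto
  thus False using \<mu>(2) closure_subset by blast
qed

section \<open>The boundary of the pseudospectrum\<close>

text \<open>A frontier point belongs to the closed pseudospectrum but admits no vector with strict inequality.
  So the smallest singular value equals the bound, and a vector attaining it lies in the kernel.\<close>

lemma singular_gram_on_frontier:
  fixes P :: "nat \<Rightarrow> complex^'n^'n"
  assumes w: "w 0 > 0" "\<forall>j\<in>{1..m}. w j \<ge> 0" and \<epsilon>: "\<epsilon> > 0"
    and z: "z \<in> frontier (pseudospectrum m P \<epsilon> w)"
  shows "det (gram_shift (matpoly_eval m P z) (\<epsilon> * weight m w (cmod z))) = 0"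
proof -
  let ?A = "matpoly_eval m P z" and ?\<tau> = "\<epsilon> * weight m w (cmod z)"
  have \<tau>: "?\<tau> > 0" using weight_pos[OF w, of "cmod z"] \<epsilon> by simp
  have "z \<notin> interior (pseudospectrum m P \<epsilon> w)" using z by (simp add: frontier_def)
  hence ge: "?\<tau> * norm v \<le> norm (?A *v v)" for v
    using interior_pseudospectrumI[OF w \<epsilon>, where P = P and \<mu> = z and v = v] by (meson not_le)
  have "z \<in> pseudospectrum m P \<epsilon> w"
    using z closed_pseudospectrum[OF w \<epsilon>, of P] by (simp add: frontier_def)
  then obtain v where "v \<noteq> 0" "norm (?A *v v) \<le> ?\<tau> * norm v"
    unfolding pseudospectrum_iff[OF w \<epsilon>] by blast
  moreover from this have "gram_shift ?A ?\<tau> *v v = 0"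
    using ge \<tau> by (intro minimiser_in_gram_shift_kernel antisym) (auto simp: less_imp_le)
  ultimately show ?thesis using det_eq_0_iff_kernel by blast
qed

lemma regular_gram_outside:
  fixes P :: "nat \<Rightarrow> complex^'n^'n"
  assumes w: "w 0 > 0" "\<forall>j\<in>{1..m}. w j \<ge> 0" and \<epsilon>: "\<epsilon> > 0"
    and z: "z \<notin> pseudospectrum m P \<epsilon> w"
  shows "det (gram_shift (matpoly_eval m P z) (\<epsilon> * weight m w (cmod z))) \<noteq> 0"
proof
  assume "det (gram_shift (matpoly_eval m P z) (\<epsilon> * weight m w (cmod z))) = 0"
  then obtain v where "v \<noteq> 0" "gram_shift (matpoly_eval m P z) (\<epsilon> * weight m w (cmod z)) *v v = 0"
    using det_eq_0_iff_kernel by blast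
  moreover from this have "norm (matpoly_eval m P z *v v) = \<epsilon> * weight m w (cmod z) * norm v"
    using weight_pos[OF w, of "cmod z"] \<epsilon> by (intro gram_shift_kernel_norm) auto
  ultimately show False using z unfolding pseudospectrum_iff[OF w \<epsilon>] by auto
qed

lemma complex_radial_poly_det_gram:
  fixes P :: "nat \<Rightarrow> complex^'n^'n"
  shows "complex_radial_poly (\<lambda>z. det (gram_shift (matpoly_eval m P z) (\<epsilon> * weight m w (cmod z))))"
proof (rule complex_radial_poly_det)
  fix i j
  have "gram_shift (matpoly_eval m P z) (\<epsilon> * weight m w (cmod z)) $ i $ j =
      (\<Sum>k\<in>UNIV. cnj (\<Sum>l\<le>m. z ^ l * P l $ k $ i) * (\<Sum>l\<le>m. z ^ l * P l $ k $ j))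
      - (if i = j then (of_real \<epsilon> * (\<Sum>j\<le>m. of_real (w j) * of_real (cmod z) ^ j))\<^sup>2 else 0)" for z
    unfolding gram_shift_def
    by (simp add: matrix_matrix_mult_def conj_transpose_def matpoly_eval_nth mat_def weight_def)
  moreover have "complex_radial_poly (\<lambda>z.
      (\<Sum>k\<in>UNIV. cnj (\<Sum>l\<le>m. z ^ l * P l $ k $ i) * (\<Sum>l\<le>m. z ^ l * P l $ k $ j))
      - (if i = j then (of_real \<epsilon> * (\<Sum>j\<le>m. of_real (w j) * of_real (cmod z) ^ j))\<^sup>2 else 0))"
    by (cases "i = j"; simp only: if_True if_False simp_thms; intro complex_radial_poly_intros)
  ultimately show "complex_radial_poly
      (\<lambda>z. gram_shift (matpoly_eval m P z) (\<epsilon> * weight m w (cmod z)) $ i $ j)" by simp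
qed

lemma frontier_pseudospectrum_algebraic:
  fixes P :: "nat \<Rightarrow> complex^'n^'n"
  assumes w: "w 0 > 0" "\<forall>j\<in>{1..m}. w j \<ge> 0" and \<epsilon>: "\<epsilon> > 0"
    and "pseudospectrum m P \<epsilon> w \<noteq> UNIV"
  shows "\<exists>f. f \<noteq> 0 \<and> (\<forall>z\<in>frontier (pseudospectrum m P \<epsilon> w). bieval f (Re z) (Im z) = 0)"
proof -
  let ?d = "\<lambda>z. det (gram_shift (matpoly_eval m P z) (\<epsilon> * weight m w (cmod z)))"
  \<comment> \<open>the squared modulus of the determinant, which is real-valued and has the same zeros\<close>
  let ?g = "\<lambda>z. Re (?d z) * Re (?d z) + Im (?d z) * Im (?d z)"
  have g0: "?g z = 0 \<longleftrightarrow> ?d z = 0" for z by (simp add: complex_eq_iff sum_squares_eq_zero_iff)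
  have "radial_poly ?g"
    using complex_radial_poly_det_gram[of m P \<epsilon> w] unfolding complex_radial_poly_def
    by (intro radial_poly_add radial_poly_mult) auto
  moreover obtain z0 where "z0 \<notin> pseudospectrum m P \<epsilon> w" using assms(4) by blast
  hence "?g z0 \<noteq> 0" using regular_gram_outside[OF w \<epsilon>] g0 by blast
  ultimately obtain f where "f \<noteq> 0" "\<And>z. ?g z = 0 \<Longrightarrow> bieval f (Re z) (Im z) = 0"
    using radial_poly_zeros_on_algebraic_curve[of ?g z0] by blast
  thus ?thesis using singular_gram_on_frontier[OF w \<epsilon>, of _ P] g0 by blast
qed

theorem theorem7:
  fixes P :: "nat \<Rightarrow> complex^'n^'n" and w :: "nat \<Rightarrow> real" and m :: nat and \<epsilon> :: real
  assumes "m \<ge> 1"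
    and "det (P m) \<noteq> 0"
    and "w 0 > 0"
    and "\<forall>j\<in>{1..m}. w j \<ge> 0"
    and "\<epsilon> > 0"
    and "pseudospectrum m P \<epsilon> w \<noteq> UNIV"
  shows "(\<exists>C. algebraic_curve C \<and> frontier (pseudospectrum m P \<epsilon> w) \<subseteq> C) \<and>
    (\<exists>c. piecewise_smooth_curve c \<and>
         curve_image c = frontier (pseudospectrum m P \<epsilon> w) \<and>
         finite {z \<in> frontier (pseudospectrum m P \<epsilon> w).
                   \<not> has_tangent (frontier (pseudospectrum m P \<epsilon> w)) z} \<and>
         finite (self_intersections c))"
proof -
  obtain f where f: "f \<noteq> 0"
    "\<And>z. z \<in> frontier (pseudospectrum m P \<epsilon> w) \<Longrightarrow> bieval f (Re z) (Im z) = 0"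
    using frontier_pseudospectrum_algebraic[OF assms(3-6)] by blast
  have "algebraic_curve {z. bieval f (Re z) (Im z) = 0}"
    unfolding algebraic_curve_def bieval_def using f(1) by blast
  moreover have "frontier (pseudospectrum m P \<epsilon> w) \<subseteq> {z. bieval f (Re z) (Im z) = 0}"
    using f(2) by blast
  ultimately show ?thesis
    using algebraic_frontier_piecewise_smooth[OF closed_pseudospectrum[OF assms(3-5)]
        pseudospectrum_subset_closure_interior[OF assms(3-5)] f] by blast
qed

end
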